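(* Let $I$ be the two-sided ideal of $U^{\mathrm{rtt}}_v(L\mathfrak{gl}_n)$ generated by $\{t^+_{11}[s],\,t^-_{11}[-s]\}_{s\geq2}\cup\{t^+_{11}[1]+t^-_{11}[0],\ t^-_{11}[-1]+t^+_{11}[0]\}$. Then $\operatorname{Ker}(\mathrm{ev}^{\mathrm{rtt}})=\mathfrak{U}^{\mathrm{rtt}}_v(L\mathfrak{gl}_n)\cap I$.
   Context: Let $v$ be a formal variable, $E_{ij}$ matrix units of $\operatorname{End}\mathbb{C}^n$. Set $R=v^{-1}\sum_iE_{ii}\otimes E_{ii}+\sum_{i\neq j}E_{ii}\otimes E_{jj}+(v^{-1}-v)\sum_{i>j}E_{ij}\otimes E_{ji}$ and $R_{\mathrm{trig}}(z,w)=(vz-v^{-1}w)\sum_iE_{ii}\otimes E_{ii}+(z-w)\sum_{i\neq j}E_{ii}\otimes E_{jj}+(v-v^{-1})z\sum_{i<j}E_{ij}\otimes E_{ji}+(v-v^{-1})w\sum_{i>j}E_{ij}\otimes E_{ji}$. $\mathfrak{U}^{\mathrm{rtt}}_v(\mathfrak{gl}_n)$ is the associative $\mathbb{C}[v,v^{-1}]$-algebra generated by $\{t^\pm_{ij}\}_{i,j=1}^n$ with relations $t^\pm_{ii}t^\mp_{ii}=1$; $t^+_{ij}=t^-_{ji}=0$ for $j<i$; $RT^+_1T^+_2=T^+_2T^+_1R$, $RT^-_1T^-_2=T^-_2T^-_1R$, $RT^-_1T^+_2=T^+_2T^-_1R$, where $T^\pm=\sum t^\pm_{ij}\otimes E_{ij}$.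 $\mathfrak{U}^{\mathrm{rtt}}_v(L\mathfrak{gl}_n)$ is the associative $\mathbb{C}[v,v^{-1}]$-algebra generated by $\{t^\pm_{ij}[\pm r]\}_{1\leq i,j\leq n}^{r\in\mathbb{N}}$ with relations $t^\pm_{ii}[0]t^\mp_{ii}[0]=1$; $t^+_{ij}[0]=t^-_{ji}[0]=0$ for $j<i$; $R_{\mathrm{trig}}(z,w)T^\epsilon_1(z)T^{\epsilon'}_2(w)=T^{\epsilon'}_2(w)T^{\epsilon}_1(z)R_{\mathrm{trig}}(z,w)$ for $(\epsilon,\epsilon')\in\{(+,+),(-,-),(-,+)\}$, where $T^\pm(z)=\sum_{i,j}t^\pm_{ij}(z)\otimes E_{ij}$, $t^\pm_{ij}(z)=\sum_{r\geq0}t^\pm_{ij}[\pm r]z^{\mp r}$. Set $U^{\mathrm{rtt}}_v(L\mathfrak{gl}_n)=\mathfrak{U}^{\mathrm{rtt}}_v(L\mathfrak{gl}_n)\otimes_{\mathbb{C}[v,v^{-1}]}\mathbb{C}(v)$, into which $\mathfrak{U}^{\mathrm{rtt}}_v(L\mathfrak{gl}_n)$ embeds naturally. The RTT evaluation homomorphism $\mathrm{ev}^{\mathrm{rtt}}\colon\mathfrak{U}^{\mathrm{rtt}}_v(L\mathfrak{gl}_n)\twoheadrightarrow\mathfrak{U}^{\mathrm{rtt}}_v(\mathfrak{gl}_n)$ is the (well-defined, surjective) $\mathbb{C}[v,v^{-1}]$-algebra homomorphism given by $T^+(z)\mapsto T^+-T^-z^{-1}$, $T^-(z)\mapsto T^--T^+z$.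 *)

theory Defs
  imports "HOL-Library.Poly_Mapping" "HOL-Computational_Algebra.Polynomial"
          "HOL-Computational_Algebra.Fraction_Field"
begin

type_synonym K = "complex poly fract"

definition vv :: K where "vv = Fract [:0, 1:] 1"

definition Laur :: "K set" where
  "Laur = {x. \<exists>p k. x = Fract p ([:0, 1:] ^ k)}"

datatype 'g word = Word "'g list"

fun letters :: "'g word \<Rightarrow> 'g list" where "letters (Word xs) = xs"

lemma Word_letters [simp]: "Word (letters a) = a" by (cases a) simp

instantiation word :: (type) monoid_add
begin
definition zero_word_def: "0 = Word []"
definition plus_word_def: "a + b = Word (letters a @ letters b)"
instance by standard (auto simp: zero_word_def plus_word_def elim: letters.elims)
end

text \<open>Free K-algebra on generators of type 'g (multiplication = concatenation of words).\<close>
type_synonym 'g free = "'g word \<Rightarrow>\<^sub>0 K"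

definition scal :: "K \<Rightarrow> 'g free" where "scal c = Poly_Mapping.single 0 c"
definition gen :: "'g \<Rightarrow> 'g free" where "gen g = Poly_Mapping.single (Word [g]) 1"
definition mon :: "'g word \<Rightarrow> 'g free" where "mon w = Poly_Mapping.single w 1"

definition free_over :: "K set \<Rightarrow> 'g set \<Rightarrow> 'g free set" where
  "free_over C G = {f. \<forall>w\<in>Poly_Mapping.keys f. Poly_Mapping.lookup f w \<in> C \<and> set (letters w) \<subseteq> G}"

inductive_set ideal_gen :: "K set \<Rightarrow> 'g set \<Rightarrow> 'g free set \<Rightarrow> 'g free set"
  for C G S where
  zero: "0 \<in> ideal_gen C G S"
| add: "x \<in> ideal_gen C G S \<Longrightarrow> y \<in> ideal_gen C G S \<Longrightarrow> x + y \<in> ideal_gen C G S"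
| gen: "s \<in> S \<Longrightarrow> c \<in> C \<Longrightarrow> set (letters u) \<subseteq> G \<Longrightarrow> set (letters w) \<subseteq> G \<Longrightarrow>
        scal c * mon u * s * mon w \<in> ideal_gen C G S"

definition subst :: "('g \<Rightarrow> 'h free) \<Rightarrow> 'g free \<Rightarrow> 'h free" where
  "subst \<phi> f = (\<Sum>w\<in>Poly_Mapping.keys f. scal (Poly_Mapping.lookup f w) * prod_list (map \<phi> (letters w)))"

definition EE :: "nat \<Rightarrow> nat \<Rightarrow> nat \<Rightarrow> nat \<Rightarrow> K" where
  "EE i j a c = (if a = i \<and> c = j then 1 else 0)"

text \<open>Entry ((a,b),(c,d)) of X = sum of coefficient * E_.. tensor E_.., i.e. coefficient
  of E_ac tensor E_bd.\<close>
definition Rconst :: "nat \<Rightarrow> nat \<Rightarrow> nat \<Rightarrow> nat \<Rightarrow> nat \<Rightarrow> K" where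
  "Rconst n a b c d =
     inverse vv * (\<Sum>i\<in>{1..n}. EE i i a c * EE i i b d)
   + (\<Sum>i\<in>{1..n}. \<Sum>j\<in>{1..n}. if i \<noteq> j then EE i i a c * EE j j b d else 0)
   + (inverse vv - vv) * (\<Sum>i\<in>{1..n}. \<Sum>j\<in>{1..n}. if i > j then EE i j a c * EE j i b d else 0)"

text \<open>R_trig(z,w) = z * Rz + w * Rw, entrywise.\<close>
definition Rz :: "nat \<Rightarrow> nat \<Rightarrow> nat \<Rightarrow> nat \<Rightarrow> nat \<Rightarrow> K" where
  "Rz n a b c d =
     vv * (\<Sum>i\<in>{1..n}. EE i i a c * EE i i b d)
   + (\<Sum>i\<in>{1..n}. \<Sum>j\<in>{1..n}. if i \<noteq> j then EE i i a c * EE j j b d else 0)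
   + (vv - inverse vv) * (\<Sum>i\<in>{1..n}. \<Sum>j\<in>{1..n}. if i < j then EE i j a c * EE j i b d else 0)"

definition Rw :: "nat \<Rightarrow> nat \<Rightarrow> nat \<Rightarrow> nat \<Rightarrow> nat \<Rightarrow> K" where
  "Rw n a b c d =
     - inverse vv * (\<Sum>i\<in>{1..n}. EE i i a c * EE i i b d)
   - (\<Sum>i\<in>{1..n}. \<Sum>j\<in>{1..n}. if i \<noteq> j then EE i i a c * EE j j b d else 0)
   + (vv - inverse vv) * (\<Sum>i\<in>{1..n}. \<Sum>j\<in>{1..n}. if i > j then EE i j a c * EE j i b d else 0)"

datatype fgen = TP nat nat | TM nat nat

definition fgens :: "nat \<Rightarrow> fgen set" where
  "fgens n = {TP i j | i j. i \<in> {1..n} \<and> j \<in> {1..n}} \<union> {TM i j | i j. i \<in> {1..n} \<and> j \<in> {1..n}}"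

definition fT :: "bool \<Rightarrow> nat \<Rightarrow> nat \<Rightarrow> fgen free" where
  "fT e i j = gen (if e then TP i j else TM i j)"

text \<open>(R X_1 Y_2 - Y_2 X_1 R) at entry ((a,b),(c,d)), where (X_1 Y_2)_{(a,b),(c,d)} = X_ac Y_bd
  and (Y_2 X_1)_{(a,b),(c,d)} = Y_bd X_ac.\<close>
definition frtt :: "nat \<Rightarrow> bool \<Rightarrow> bool \<Rightarrow> nat \<Rightarrow> nat \<Rightarrow> nat \<Rightarrow> nat \<Rightarrow> fgen free" where
  "frtt n e e' a b c d =
     (\<Sum>p\<in>{1..n}. \<Sum>q\<in>{1..n}. scal (Rconst n a b p q) * fT e p c * fT e' q d)
   - (\<Sum>p\<in>{1..n}. \<Sum>q\<in>{1..n}. fT e' b q * fT e a p * scal (Rconst n p q c d))"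

definition frels :: "nat \<Rightarrow> fgen free set" where
  "frels n =
     {gen (TP i i) * gen (TM i i) - 1 | i. i \<in> {1..n}}
   \<union> {gen (TM i i) * gen (TP i i) - 1 | i. i \<in> {1..n}}
   \<union> {gen (TP i j) | i j. i \<in> {1..n} \<and> j \<in> {1..n} \<and> j < i}
   \<union> {gen (TM j i) | i j. i \<in> {1..n} \<and> j \<in> {1..n} \<and> j < i}
   \<union> {frtt n e e' a b c d | e e' a b c d. (e, e') \<in> {(True, True), (False, False), (False, True)}
        \<and> {a, b, c, d} \<subseteq> {1..n}}"

text \<open>LTP i j r = t^+_ij[r], LTM i j r = t^-_ij[-r], r in N.\<close>
datatype lgen = LTP nat nat nat | LTM nat nat nat

definition lgens :: "nat \<Rightarrow> lgen set" where
  "lgens n = {LTP i j r | i j r. i \<in> {1..n} \<and> j \<in> {1..n}}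
           \<union> {LTM i j r | i j r. i \<in> {1..n} \<and> j \<in> {1..n}}"

text \<open>Coefficient of z^p (p in Z) in t^eps_ij(z): t^+_ij(z) = sum_r t^+_ij[r] z^-r,
  t^-_ij(z) = sum_r t^-_ij[-r] z^r.\<close>
definition LT :: "bool \<Rightarrow> nat \<Rightarrow> nat \<Rightarrow> int \<Rightarrow> lgen free" where
  "LT e i j p = (if e then (if p \<le> 0 then gen (LTP i j (nat (- p))) else 0)
                      else (if p \<ge> 0 then gen (LTM i j (nat p)) else 0))"

text \<open>Coefficient of z^p w^q of R_trig(z,w) T^e_1(z) T^e'_2(w) - T^e'_2(w) T^e_1(z) R_trig(z,w)
  at entry ((a,b),(c,d)), with R_trig(z,w) = z Rz + w Rw.\<close>
definition lrtt :: "nat \<Rightarrow> bool \<Rightarrow> bool \<Rightarrow> nat \<Rightarrow> nat \<Rightarrow> nat \<Rightarrow> nat \<Rightarrow> int \<Rightarrow> int \<Rightarrow> lgen free" where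
  "lrtt n e e' a b c d p q =
     (\<Sum>s\<in>{1..n}. \<Sum>t\<in>{1..n}.
         scal (Rz n a b s t) * LT e s c (p - 1) * LT e' t d q
       + scal (Rw n a b s t) * LT e s c p * LT e' t d (q - 1))
   - (\<Sum>s\<in>{1..n}. \<Sum>t\<in>{1..n}.
         LT e' b t q * LT e a s (p - 1) * scal (Rz n s t c d)
       + LT e' b t (q - 1) * LT e a s p * scal (Rw n s t c d))"

definition lrels :: "nat \<Rightarrow> lgen free set" where
  "lrels n =
     {gen (LTP i i 0) * gen (LTM i i 0) - 1 | i. i \<in> {1..n}}
   \<union> {gen (LTM i i 0) * gen (LTP i i 0) - 1 | i. i \<in> {1..n}}
   \<union> {gen (LTP i j 0) | i j. i \<in> {1..n} \<and> j \<in> {1..n} \<and> j < i}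
   \<union> {gen (LTM j i 0) | i j. i \<in> {1..n} \<and> j \<in> {1..n} \<and> j < i}
   \<union> {lrtt n e e' a b c d p q | e e' a b c d p q.
        (e, e') \<in> {(True, True), (False, False), (False, True)} \<and> {a, b, c, d} \<subseteq> {1..n}}"

text \<open>T^+(z) |-> T^+ - T^- z^-1, T^-(z) |-> T^- - T^+ z, read off coefficientwise.\<close>
fun evgen :: "lgen \<Rightarrow> fgen free" where
  "evgen (LTP i j r) = (if r = 0 then gen (TP i j) else if r = 1 then - gen (TM i j) else 0)"
| "evgen (LTM i j r) = (if r = 0 then gen (TM i j) else if r = 1 then - gen (TP i j) else 0)"

definition Igens :: "lgen free set" where
  "Igens = {gen (LTP 1 1 s) | s. s \<ge> 2} \<union> {gen (LTM 1 1 s) | s. s \<ge> 2}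
         \<union> {gen (LTP 1 1 1) + gen (LTM 1 1 0), gen (LTM 1 1 1) + gen (LTP 1 1 0)}"

end

theory Submission
  imports Defs "HOL-Library.Nat_Bijection"
begin

text \<open>
  Over \<open>\<complex>(v)\<close>, let \<open>C(z) = T\<^sup>-(z) + z T\<^sup>+(z)\<close>. The RTT relations are linear in the first factor, so
  they also hold between \<open>C(z)\<close> and \<open>T\<^sup>+(w)\<close>. Modulo the ideal \<open>I\<close> the entry \<open>C\<^sub>1\<^sub>1(z)\<close> vanishes, and
  these relations, after division by \<open>v\<^sup>-\<^sup>1 - v\<close> and by the invertible \<open>t\<^sup>+\<^sub>1\<^sub>1[0]\<close>, force first the
  entries \<open>C\<^sub>1\<^sub>j(z)\<close> and then all entries to vanish. Hence the zero modes generate the quotient by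
  \<open>I\<close>, they satisfy the finite RTT relations, and evaluation identifies this quotient with the finite
  RTT algebra over \<open>\<complex>(v)\<close>.

  Descending to \<open>\<complex>[v,v\<^sup>-\<^sup>1]\<close> amounts to torsion-freeness of the integral finite RTT algebra, that is to
  a PBW theorem. Ordered words span over \<open>\<complex>[v,v\<^sup>-\<^sup>1]\<close>, because for a suitable degree any two generators
  commute up to a unit modulo terms of lower degree. They are linearly independent over \<open>\<complex>(v)\<close> in the
  tensor powers of the vector representation: the diagonal generators act by powers of \<open>v\<close> read off
  from the weight, and the off-diagonal ones, divided by \<open>v\<^sup>-\<^sup>1 - v\<close>, specialise at \<open>v = 1\<close> to the
  operators replacing a letter \<open>j\<close> by \<open>i\<close>, where a leading term is detected by letting every
  generator act on its own letter.
\<close>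

abbreviation lookup :: "('a \<Rightarrow>\<^sub>0 'b::zero) \<Rightarrow> 'a \<Rightarrow> 'b" where
  "lookup \<equiv> Poly_Mapping.lookup"

abbreviation keys :: "('a \<Rightarrow>\<^sub>0 'b::zero) \<Rightarrow> 'a set" where
  "keys \<equiv> Poly_Mapping.keys"

section \<open>The free algebra\<close>

lemma single_eq_scal_mon: "Poly_Mapping.single w c = scal c * mon w"
  by (simp add: scal_def mon_def mult_single)

lemma mon_zero [simp]: "mon 0 = 1"
  by (simp add: mon_def)

lemma mon_plus: "mon (u + w) = mon u * mon w"
  by (simp add: mon_def mult_single)

lemma mon_append: "mon (Word (xs @ ys)) = mon (Word xs) * mon (Word ys)"
  by (simp add: plus_word_def flip: mon_plus)

lemma gen_eq_mon: "gen g = mon (Word [g])"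
  by (simp add: gen_def mon_def)

lemma mon_Nil [simp]: "mon (Word []) = 1"
  using mon_zero by (simp add: zero_word_def)

lemma mon_Cons: "mon (Word (g # xs)) = gen g * mon (Word xs)"
  using mon_append[of "[g]" xs] by (simp add: gen_eq_mon)

lemma lookup_scal_mult [simp]: "lookup (scal c * f) w = c * lookup f w"
  unfolding scal_def mult_map_scale_conv_mult[symmetric]
  by (simp add: Poly_Mapping.map.rep_eq when_def)

lemma scal_add: "scal (a + b) = scal a + scal b"
  by (simp add: scal_def single_add)

lemma scal_diff: "scal (a - b) = scal a - scal b"
  by (simp add: scal_def single_diff)

lemma scal_uminus: "scal (- a) = - scal a"
  by (simp add: scal_def single_uminus)

lemma scal_mult: "scal (a * b) = scal a * scal b"
  by (simp add: scal_def mult_single)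

lemma scal_0 [simp]: "scal 0 = 0"
  by (simp add: scal_def)

lemma scal_1 [simp]: "scal 1 = 1"
  by (simp add: scal_def)

lemma scal_scal: "scal a * (scal b * x) = scal (a * b) * x"
  by (simp add: scal_mult mult.assoc)

lemma free_expand: "f = (\<Sum>w\<in>keys f. scal (lookup f w) * mon w)"
proof (rule poly_mapping_eqI)
  fix u
  have "lookup (\<Sum>w\<in>keys f. scal (lookup f w) * mon w) u
      = (\<Sum>w\<in>keys f. if w = u then lookup f w else 0)"
    by (simp add: lookup_sum mon_def lookup_single when_def if_distrib cong: if_cong)
  also have "\<dots> = lookup f u"
    by (simp add: not_in_keys_iff_lookup_eq_zero)
  finally show "lookup f u = lookup (\<Sum>w\<in>keys f. scal (lookup f w) * mon w) u"
    by simp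
qed

lemma free_induct [case_names zero step]:
  assumes "P 0" and "\<And>c w f. P f \<Longrightarrow> P (scal c * mon w + f)"
  shows "P f"
proof -
  have "P (\<Sum>w\<in>A. scal (lookup f w) * mon w)" if "finite A" for A
    using that by induction (auto simp: assms)
  then show ?thesis
    by (subst free_expand) simp
qed

lemma scal_central: "x * scal c = scal c * x"
proof (induction x rule: free_induct)
  case (step d w f)
  have "mon w * scal c = scal c * mon w"
    by (simp add: scal_def mon_def mult_single)
  then have "scal d * mon w * scal c = scal (d * c) * mon w"
    by (simp add: mult.assoc scal_mult)
  then show ?case
    by (simp only: step distrib_right distrib_left scal_scal mult.commute)
qed simp

lemma scal_left_commute: "x * (scal c * y) = scal c * (x * y)"
  by (metis mult.assoc scal_central)

lemma term_mult: "scal c * mon w * (scal d * mon u) = scal (c * d) * mon (w + u)"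
  by (simp add: mult_single flip: single_eq_scal_mon)

subsection \<open>Linear extension\<close>

text \<open>Cancellation can make the support of \<open>f + g\<close> smaller than the union of the
  supports; \<open>X w 0 = 0\<close> makes this harmless. It serves both \<open>subst\<close> and
  the action \<open>act\<close> on tensor powers.\<close>

lemma sum_keys_add:
  fixes X :: "'g word \<Rightarrow> K \<Rightarrow> 'b::comm_monoid_add"
  assumes "\<And>w. X w 0 = 0" and "\<And>w a b. X w (a + b) = X w a + X w b"
  shows "(\<Sum>w\<in>keys (f + g). X w (lookup (f + g) w))
       = (\<Sum>w\<in>keys f. X w (lookup f w)) + (\<Sum>w\<in>keys g. X w (lookup g w))"
  using assms by (intro setsum_keys_plus_distrib) auto

lemma sum_keys_term:
  fixes X :: "'g word \<Rightarrow> K \<Rightarrow> 'b::comm_monoid_add"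
  assumes "X w 0 = 0"
  shows "(\<Sum>u\<in>keys (scal c * mon w). X u (lookup (scal c * mon w) u)) = X w c"
  using assms by (simp add: lookup_single flip: single_eq_scal_mon)

lemma subst_add: "subst \<phi> (f + g) = subst \<phi> f + subst \<phi> g"
  unfolding subst_def by (rule sum_keys_add) (simp_all add: scal_add distrib_right)

lemma subst_term: "subst \<phi> (scal c * mon w) = scal c * prod_list (map \<phi> (letters w))"
  unfolding subst_def by (rule sum_keys_term) simp

lemma subst_zero [simp]: "subst \<phi> 0 = 0"
  by (simp add: subst_def)

lemma subst_mult_scal_mon:
  "subst \<phi> (scal c * mon w * g) = subst \<phi> (scal c * mon w) * subst \<phi> g"
proof (induction g rule: free_induct)
  case (step d u g)
  have "subst \<phi> (scal c * mon w * (scal d * mon u))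
      = scal (c * d) * prod_list (map \<phi> (letters (w + u)))"
    by (simp only: subst_term term_mult)
  also have "\<dots> = subst \<phi> (scal c * mon w) * subst \<phi> (scal d * mon u)"
    by (simp add: subst_term plus_word_def mult.assoc scal_mult
        scal_left_commute[of "prod_list xs" for xs])
  finally show ?case
    by (simp add: distrib_left subst_add step)
qed simp

lemma subst_mult: "subst \<phi> (f * g) = subst \<phi> f * subst \<phi> g"
  by (induction f rule: free_induct) (simp_all add: distrib_right subst_add subst_mult_scal_mon)

lemma subst_scal [simp]: "subst \<phi> (scal c) = scal c"
  using subst_term[of \<phi> c 0] by (simp add: zero_word_def)

lemma subst_one [simp]: "subst \<phi> 1 = 1"
  using subst_scal[of \<phi> 1] by simp

lemma subst_gen [simp]: "subst \<phi> (gen g) = \<phi> g"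
  using subst_term[of \<phi> 1 "Word [g]"] by (simp add: gen_eq_mon)

lemma subst_mon: "subst \<phi> (mon w) = prod_list (map \<phi> (letters w))"
  using subst_term[of \<phi> 1 w] by simp

lemma subst_uminus: "subst \<phi> (- f) = - subst \<phi> f"
  using subst_add[of \<phi> f "- f"] by (simp add: eq_neg_iff_add_eq_0 add.commute)

lemma subst_diff: "subst \<phi> (f - g) = subst \<phi> f - subst \<phi> g"
  using subst_add[of \<phi> f "- g"] by (simp add: subst_uminus)

lemmas subst_simps = subst_add subst_mult subst_uminus subst_diff

subsection \<open>Ideals over a ring of scalars\<close>

text \<open>Both scalar rings that occur, \<open>Laur\<close> and the whole field
  \<open>UNIV\<close>, satisfy this, so the ideal calculus is done once for both.\<close>

definition scalar_ring :: "K set \<Rightarrow> bool" where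
  "scalar_ring C \<longleftrightarrow> 1 \<in> C \<and> (\<forall>x\<in>C. \<forall>y\<in>C. x - y \<in> C \<and> x * y \<in> C)"

context
  fixes C :: "K set"
  assumes C: "scalar_ring C"
begin

lemma C_one: "1 \<in> C" and C_zero: "0 \<in> C"
  using C by (auto simp: scalar_ring_def) (metis cancel_comm_monoid_add_class.diff_cancel)

lemma C_diff: "x \<in> C \<Longrightarrow> y \<in> C \<Longrightarrow> x - y \<in> C"
  using C by (auto simp: scalar_ring_def)

lemma C_mult: "x \<in> C \<Longrightarrow> y \<in> C \<Longrightarrow> x * y \<in> C"
  using C by (auto simp: scalar_ring_def)

lemma C_uminus: "x \<in> C \<Longrightarrow> - x \<in> C"
  using C_diff[of 0 x] C_zero by simp

lemma C_add: "x \<in> C \<Longrightarrow> y \<in> C \<Longrightarrow> x + y \<in> C"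
  using C_diff[of x "- y"] C_uminus by simp

lemma ideal_scal: "x \<in> ideal_gen C G S \<Longrightarrow> c \<in> C \<Longrightarrow> scal c * x \<in> ideal_gen C G S"
proof (induction rule: ideal_gen.induct)
  case (gen s d u w)
  have "scal c * (scal d * mon u * s * mon w) = scal (c * d) * mon u * s * mon w"
    by (simp add: scal_mult mult.assoc)
  with gen show ?case
    by (metis C_mult ideal_gen.gen)
qed (auto simp: distrib_left intro: ideal_gen.intros)

lemma ideal_uminus: "x \<in> ideal_gen C G S \<Longrightarrow> - x \<in> ideal_gen C G S"
  using ideal_scal[of x G S "-1"] C_one C_uminus by (simp add: scal_uminus)

lemma ideal_diff: "x \<in> ideal_gen C G S \<Longrightarrow> y \<in> ideal_gen C G S \<Longrightarrow> x - y \<in> ideal_gen C G S"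
  using ideal_gen.add[of x C G S "- y"] ideal_uminus[of y] by simp

lemma ideal_mon_left:
  "x \<in> ideal_gen C G S \<Longrightarrow> set (letters w) \<subseteq> G \<Longrightarrow> mon w * x \<in> ideal_gen C G S"
proof (induction rule: ideal_gen.induct)
  case (gen s d u w')
  have "mon w * (scal d * mon u * s * mon w') = scal d * mon (w + u) * s * mon w'"
    by (simp add: mon_plus mult.assoc scal_left_commute)
  moreover have "set (letters (w + u)) \<subseteq> G"
    using gen by (simp add: plus_word_def)
  ultimately show ?case
    using gen by (metis ideal_gen.gen)
qed (auto simp: distrib_left intro: ideal_gen.intros)

lemma ideal_mon_right:
  "x \<in> ideal_gen C G S \<Longrightarrow> set (letters w) \<subseteq> G \<Longrightarrow> x * mon w \<in> ideal_gen C G S"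
proof (induction rule: ideal_gen.induct)
  case (gen s d u w')
  have "scal d * mon u * s * mon w' * mon w = scal d * mon u * s * mon (w' + w)"
    by (simp add: mon_plus mult.assoc)
  moreover have "set (letters (w' + w)) \<subseteq> G"
    using gen by (simp add: plus_word_def)
  ultimately show ?case
    using gen by (metis ideal_gen.gen)
qed (auto simp: distrib_right intro: ideal_gen.intros)

lemma ideal_base: "s \<in> S \<Longrightarrow> s \<in> ideal_gen C G S"
  using ideal_gen.gen[of s S 1 C 0 G 0] C_one by (simp add: zero_word_def)

lemma ideal_gen_left: "x \<in> ideal_gen C G S \<Longrightarrow> g \<in> G \<Longrightarrow> gen g * x \<in> ideal_gen C G S"
  using ideal_mon_left[of x G S "Word [g]"] by (simp add: gen_eq_mon)

lemma free_over_zero: "0 \<in> free_over C G"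
  by (simp add: free_over_def)

lemma free_over_iff:
  "f \<in> free_over C G \<longleftrightarrow> (\<forall>w. lookup f w \<in> C \<and> (lookup f w \<noteq> 0 \<longrightarrow> set (letters w) \<subseteq> G))"
  unfolding free_over_def using C_zero by (auto simp: in_keys_iff)

lemma free_over_add: "f \<in> free_over C G \<Longrightarrow> g \<in> free_over C G \<Longrightarrow> f + g \<in> free_over C G"
proof -
  assume "f \<in> free_over C G" "g \<in> free_over C G"
  then have *: "lookup f w \<in> C \<and> (lookup f w \<noteq> 0 \<longrightarrow> set (letters w) \<subseteq> G)"
    "lookup g w \<in> C \<and> (lookup g w \<noteq> 0 \<longrightarrow> set (letters w) \<subseteq> G)" for w
    by (simp_all add: free_over_iff)
  show ?thesis
    unfolding free_over_iff lookup_add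
  proof (intro allI conjI impI)
    fix w
    show "lookup f w + lookup g w \<in> C"
      using * by (simp add: C_add)
    assume "lookup f w + lookup g w \<noteq> 0"
    then have "lookup f w \<noteq> 0 \<or> lookup g w \<noteq> 0"
      by auto
    then show "set (letters w) \<subseteq> G"
      using *[of w] by blast
  qed
qed

lemma free_over_scal: "f \<in> free_over C G \<Longrightarrow> c \<in> C \<Longrightarrow> scal c * f \<in> free_over C G"
  by (auto simp: free_over_iff C_mult)

lemma free_over_uminus: "f \<in> free_over C G \<Longrightarrow> - f \<in> free_over C G"
  by (auto simp: free_over_iff C_uminus)

lemma free_over_mon: "set (letters w) \<subseteq> G \<Longrightarrow> mon w \<in> free_over C G"
  by (auto simp: free_over_iff mon_def lookup_single when_def C_one C_zero)

lemma free_over_induct [consumes 1, case_names zero step]: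
  assumes "f \<in> free_over C G"
    and "P 0"
    and "\<And>c w f. c \<in> C \<Longrightarrow> set (letters w) \<subseteq> G \<Longrightarrow> P f \<Longrightarrow> P (scal c * mon w + f)"
  shows "P f"
proof -
  have "P (\<Sum>w\<in>A. scal (lookup f w) * mon w)" if "finite A" "A \<subseteq> keys f" for A
    using that
  proof induction
    case (insert w A)
    with assms(1) have "lookup f w \<in> C" "set (letters w) \<subseteq> G"
      by (auto simp: free_over_def)
    with insert show ?case
      by (simp add: assms(3))
  qed (simp add: assms)
  then show ?thesis
    by (subst free_expand) simp
qed

lemma free_over_mult: "f \<in> free_over C G \<Longrightarrow> g \<in> free_over C G \<Longrightarrow> f * g \<in> free_over C G"
proof (induction f rule: free_over_induct)
  case (step c w f)
  have "scal c * mon w * g \<in> free_over C G"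
    using step(4)
  proof (induction g rule: free_over_induct)
    case (step d u g)
    have "scal (c * d) * mon (w + u) \<in> free_over C G"
      using step(1,2) \<open>c \<in> C\<close> \<open>set (letters w) \<subseteq> G\<close>
      by (intro free_over_scal free_over_mon) (auto simp: plus_word_def C_mult)
    then show ?case
      using step(3) by (simp add: distrib_left free_over_add term_mult)
  qed (simp add: free_over_zero)
  with step show ?case
    by (simp add: distrib_right free_over_add)
qed (simp add: free_over_zero)

lemma ideal_mult_left:
  "f \<in> free_over C G \<Longrightarrow> x \<in> ideal_gen C G S \<Longrightarrow> f * x \<in> ideal_gen C G S"
  by (induction f rule: free_over_induct)
     (auto simp: distrib_right mult.assoc intro!: ideal_gen.add ideal_scal ideal_mon_left ideal_gen.zero)

lemma ideal_mult_right:
  "f \<in> free_over C G \<Longrightarrow> x \<in> ideal_gen C G S \<Longrightarrow> x * f \<in> ideal_gen C G S"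
  by (induction f rule: free_over_induct)
     (auto simp: distrib_left scal_left_commute
       intro!: ideal_gen.add ideal_scal ideal_mon_right ideal_gen.zero)

lemma free_over_subst:
  assumes "f \<in> free_over C G" and "\<And>g. g \<in> G \<Longrightarrow> \<phi> g \<in> free_over C H"
  shows "subst \<phi> f \<in> free_over C H"
  using assms(1)
proof (induction f rule: free_over_induct)
  case (step c w f)
  have "prod_list (map \<phi> xs) \<in> free_over C H" if "set xs \<subseteq> G" for xs
    using that assms(2) free_over_mon[of 0 H]
    by (induction xs) (auto simp: free_over_mult zero_word_def)
  with step show ?case
    by (simp add: subst_add subst_term free_over_add free_over_scal)
qed (simp add: free_over_zero)

text \<open>Used to pass homomorphisms to quotients: only the defining relations have to be
  checked.\<close>

lemma subst_ideal:
  assumes "x \<in> ideal_gen C G S"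
    and "\<And>g. g \<in> G \<Longrightarrow> \<phi> g \<in> free_over C H"
    and "\<And>s. s \<in> S \<Longrightarrow> subst \<phi> s \<in> ideal_gen C H S'"
  shows "subst \<phi> x \<in> ideal_gen C H S'"
  using assms(1)
proof induction
  case (gen s c u w)
  then have "subst \<phi> (mon u) \<in> free_over C H" "subst \<phi> (mon w) \<in> free_over C H"
    using assms(2) by (blast intro: free_over_subst free_over_mon)+
  with gen assms(3) show ?case
    by (simp add: subst_mult mult.assoc ideal_scal ideal_mult_left ideal_mult_right)
qed (auto simp: subst_add intro: ideal_gen.intros)

text \<open>The letters of a word are replaced one at a time, and each replacement changes the
  product by an element of the ideal.\<close>

lemma subst_cong_ideal:
  assumes "f \<in> free_over C G"
    and "\<And>g. g \<in> G \<Longrightarrow> \<phi> g \<in> free_over C G"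
    and "\<And>g. g \<in> G \<Longrightarrow> gen g - \<phi> g \<in> ideal_gen C G S"
  shows "f - subst \<phi> f \<in> ideal_gen C G S"
  using assms(1)
proof (induction f rule: free_over_induct)
  case (step c w f)
  have "mon (Word xs) - prod_list (map \<phi> xs) \<in> ideal_gen C G S" if "set xs \<subseteq> G" for xs
    using that
  proof (induction xs)
    case (Cons g xs)
    have "gen g * (mon (Word xs) - prod_list (map \<phi> xs)) + (gen g - \<phi> g) * prod_list (map \<phi> xs)
        \<in> ideal_gen C G S"
    proof (intro ideal_gen.add ideal_gen_left ideal_mult_right)
      have "subst \<phi> (mon (Word xs)) \<in> free_over C G"
        using Cons.prems assms(2) by (intro free_over_subst free_over_mon) auto
      then show "prod_list (map \<phi> xs) \<in> free_over C G"
        by (simp add: subst_mon)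
    qed (use Cons assms(3) in auto)
    then show ?case
      by (simp add: mon_Cons algebra_simps)
  qed (simp add: ideal_gen.zero)
  from this[of "letters w"] step have "scal c * (mon w - prod_list (map \<phi> (letters w)))
      + (f - subst \<phi> f) \<in> ideal_gen C G S"
    by (intro ideal_gen.add ideal_scal) simp_all
  then show ?case
    by (simp add: subst_add subst_term algebra_simps)
qed (simp add: ideal_gen.zero)

end

lemma scalar_ring_UNIV: "scalar_ring UNIV"
  by (simp add: scalar_ring_def)

lemma ideal_mono: "x \<in> ideal_gen C G S \<Longrightarrow> C \<subseteq> D \<Longrightarrow> x \<in> ideal_gen D G S"
  by (induction rule: ideal_gen.induct) (auto intro: ideal_gen.intros)

lemma free_over_mono: "f \<in> free_over C G \<Longrightarrow> C \<subseteq> D \<Longrightarrow> f \<in> free_over D G"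
  by (auto simp: free_over_def)

subsection \<open>Laurent polynomials in \<open>v\<close>\<close>

lemma vv_nonzero [simp]: "vv \<noteq> 0"
  by (simp add: vv_def eq_fract Zero_fract_def)


lemma scalar_ring_Laur: "scalar_ring Laur"
  unfolding scalar_ring_def
proof (intro conjI ballI)
  show "1 \<in> Laur"
    unfolding Laur_def One_fract_def by (intro CollectI exI[of _ 1] exI[of _ 0]) simp
  fix x y assume "x \<in> Laur" "y \<in> Laur"
  then obtain p k q l where x: "x = Fract p ([:0, 1:] ^ k)" and y: "y = Fract q ([:0, 1:] ^ l)"
    unfolding Laur_def by auto
  have nz: "[:0, 1:] ^ k \<noteq> (0 :: complex poly)" "[:0, 1:] ^ l \<noteq> (0 :: complex poly)"
    by simp_all
  show "x - y \<in> Laur"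
    unfolding Laur_def x y using nz by (auto simp: diff_fract simp flip: power_add)
  show "x * y \<in> Laur"
    unfolding Laur_def x y by (auto simp flip: power_add)
qed

lemma vv_Laur: "vv \<in> Laur"
  unfolding Laur_def vv_def by (intro CollectI exI[of _ "[:0, 1:]"] exI[of _ 0]) simp

lemma inverse_vv_Laur: "inverse vv \<in> Laur"
  unfolding Laur_def vv_def by (intro CollectI exI[of _ 1] exI[of _ 1]) simp

section \<open>The RTT relations entrywise\<close>

text \<open>\<open>R\<close> has diagonal entries \<open>rr\<close> and flip entries \<open>sw\<close>; its companion \<open>R\<^sub>2\<^sub>1\<^sup>-\<^sup>1\<close> has \<open>rho\<close> and \<open>-sw\<close>.\<close>

definition hh :: K where "hh = inverse vv - vv"
definition rr :: "nat \<Rightarrow> nat \<Rightarrow> K" where "rr a b = (if a = b then inverse vv else 1)"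
definition rho :: "nat \<Rightarrow> nat \<Rightarrow> K" where "rho a b = (if a = b then vv else 1)"
definition sw :: "nat \<Rightarrow> nat \<Rightarrow> K" where "sw a b = (if a < b then hh else 0)"

lemma sum_sum_delta:
  assumes "a \<in> {1..n::nat}" "b \<in> {1..n}"
  shows "(\<Sum>p\<in>{1..n}. \<Sum>q\<in>{1..n}. if p = a \<and> q = b then Z p q else 0) = (Z a b :: 'b::comm_monoid_add)"
proof -
  have "(\<Sum>q\<in>{1..n}. if p = a \<and> q = b then Z p q else 0) = (if p = a then Z a b else 0)" for p
    using assms by (cases "p = a") simp_all
  then show ?thesis
    using assms by simp
qed

lemma EE_sum_diag:
  assumes "a \<in> {1..n}"
  shows "(\<Sum>i\<in>{1..n}. EE i i a c * EE i i b d) = (if a = b \<and> c = a \<and> d = b then 1 else 0)"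
proof -
  have "EE i i a c * EE i i b d = (if i = a then if a = b \<and> c = a \<and> d = b then 1 else 0 else 0)" for i
    by (auto simp: EE_def)
  then show ?thesis
    using assms by simp
qed

lemma EE_sum_id:
  assumes "a \<in> {1..n}" "b \<in> {1..n}"
  shows "(\<Sum>i\<in>{1..n}. \<Sum>j\<in>{1..n}. if i \<noteq> j then EE i i a c * EE j j b d else 0)
    = (if a \<noteq> b \<and> c = a \<and> d = b then 1 else 0)"
proof -
  have "(if i \<noteq> j then EE i i a c * EE j j b d else 0)
    = (if i = a \<and> j = b then if a \<noteq> b \<and> c = a \<and> d = b then 1 else 0 else 0)" for i j
    by (auto simp: EE_def)
  then show ?thesis
    by (simp only: sum_sum_delta[OF assms])
qed

lemma EE_sum_flip:
  assumes "a \<in> {1..n}" "b \<in> {1..n}"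
  shows "(\<Sum>i\<in>{1..n}. \<Sum>j\<in>{1..n}. if P i j then EE i j a c * EE j i b d else 0)
    = (if P a b \<and> c = b \<and> d = a then 1 else 0)"
proof -
  have "(if P i j then EE i j a c * EE j i b d else 0)
    = (if i = a \<and> j = b then if P a b \<and> c = b \<and> d = a then 1 else 0 else 0)" for i j
    by (auto simp: EE_def)
  then show ?thesis
    by (simp only: sum_sum_delta[OF assms])
qed

lemma Rconst_entry:
  assumes "a \<in> {1..n}" "b \<in> {1..n}"
  shows "Rconst n a b c d
    = (if c = a \<and> d = b then rr a b else 0) + (if c = b \<and> d = a then sw b a else 0)"
  unfolding Rconst_def EE_sum_diag[OF assms(1)] EE_sum_id[OF assms] EE_sum_flip[OF assms]
    rr_def sw_def hh_def
  by (cases "a = b") auto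

lemma Rz_entry:
  assumes "a \<in> {1..n}" "b \<in> {1..n}"
  shows "Rz n a b c d
    = (if c = a \<and> d = b then rho a b else 0) + (if c = b \<and> d = a then - sw a b else 0)"
  unfolding Rz_def EE_sum_diag[OF assms(1)] EE_sum_id[OF assms] EE_sum_flip[OF assms]
    rho_def sw_def hh_def
  by (cases "a = b") auto

lemma R_entry_right:
  assumes "p \<in> {1..n}" "q \<in> {1..n}"
  shows "Rconst n p q c d
      = (if p = c \<and> q = d then rr c d else 0) + (if p = d \<and> q = c then sw c d else 0)"
    and "Rz n p q c d
      = (if p = c \<and> q = d then rho c d else 0) + (if p = d \<and> q = c then - sw d c else 0)"
proof -
  have *: "(if c = p \<and> d = q then X p q else 0) = (if p = c \<and> q = d then X c d else 0)"
    "(if c = q \<and> d = p then X p q else 0) = (if p = d \<and> q = c then X d c else 0)" for X :: "nat \<Rightarrow> nat \<Rightarrow> K"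
    by auto
  show "Rconst n p q c d
      = (if p = c \<and> q = d then rr c d else 0) + (if p = d \<and> q = c then sw c d else 0)"
    unfolding Rconst_entry[OF assms] by (simp only: * *(2)[of "\<lambda>p q. sw q p"])
  show "Rz n p q c d
      = (if p = c \<and> q = d then rho c d else 0) + (if p = d \<and> q = c then - sw d c else 0)"
    unfolding Rz_entry[OF assms] by (simp only: * *(2)[of "\<lambda>p q. - sw p q"])
qed

lemma Rw_eq: "Rw n a b c d = - Rconst n a b c d"
  unfolding Rw_def Rconst_def by (simp add: algebra_simps)

lemma scal_if: "scal (if P then c else 0) * x = (if P then scal c * x else 0)"
  by simp

text \<open>Each row or column of the matrix has only a diagonal and a flip entry, so a matrix
  product has two terms. For \<open>a = b\<close> both sit in the same place and add up.\<close>

lemma R_sum: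
  assumes "a \<in> {1..n::nat}" "b \<in> {1..n}"
    and "\<And>p q. p \<in> {1..n} \<Longrightarrow> q \<in> {1..n} \<Longrightarrow>
      M p q = (if p = a \<and> q = b then \<alpha> else 0) + (if p = b \<and> q = a then \<beta> else 0)"
  shows "(\<Sum>p\<in>{1..n}. \<Sum>q\<in>{1..n}. scal (M p q) * Z p q) = scal \<alpha> * Z a b + scal \<beta> * Z b a"
proof -
  have "(\<Sum>p\<in>{1..n}. \<Sum>q\<in>{1..n}. scal (M p q) * Z p q)
      = (\<Sum>p\<in>{1..n}. \<Sum>q\<in>{1..n}. (if p = a \<and> q = b then scal \<alpha> * Z p q else 0)
          + (if p = b \<and> q = a then scal \<beta> * Z p q else 0))"
    by (intro sum.cong refl) (simp only: assms(3) scal_add distrib_right scal_if)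
  also have "\<dots> = scal \<alpha> * Z a b + scal \<beta> * Z b a"
    unfolding sum.distrib by (simp only: sum_sum_delta[OF assms(1,2)] sum_sum_delta[OF assms(2,1)])
  finally show ?thesis .
qed

text \<open>\<open>rttR\<close> and \<open>rttZ\<close> are the entries of \<open>R X\<^sub>1 Y\<^sub>2 - Y\<^sub>2 X\<^sub>1 R\<close> and of
  \<open>R\<^sub>2\<^sub>1\<^sup>-\<^sup>1 X\<^sub>1 Y\<^sub>2 - Y\<^sub>2 X\<^sub>1 R\<^sub>2\<^sub>1\<^sup>-\<^sup>1\<close>; the trigonometric R-matrix is \<open>z R\<^sub>2\<^sub>1\<^sup>-\<^sup>1 - w R\<close>.\<close>

definition rttR ::
  "(nat \<Rightarrow> nat \<Rightarrow> 'g free) \<Rightarrow> (nat \<Rightarrow> nat \<Rightarrow> 'g free) \<Rightarrow> nat \<Rightarrow> nat \<Rightarrow> nat \<Rightarrow> nat \<Rightarrow> 'g free" where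
  "rttR X Y a b c d = scal (rr a b) * (X a c * Y b d) + scal (sw b a) * (X b c * Y a d)
     - scal (rr c d) * (Y b d * X a c) - scal (sw c d) * (Y b c * X a d)"

definition rttZ ::
  "(nat \<Rightarrow> nat \<Rightarrow> 'g free) \<Rightarrow> (nat \<Rightarrow> nat \<Rightarrow> 'g free) \<Rightarrow> nat \<Rightarrow> nat \<Rightarrow> nat \<Rightarrow> nat \<Rightarrow> 'g free" where
  "rttZ X Y a b c d = scal (rho a b) * (X a c * Y b d) - scal (sw a b) * (X b c * Y a d)
     - scal (rho c d) * (Y b d * X a c) + scal (sw d c) * (Y b c * X a d)"

lemma Rconst_sums:
  assumes "{a, b, c, d} \<subseteq> {1..n}"
  shows "(\<Sum>p\<in>{1..n}. \<Sum>q\<in>{1..n}. scal (Rconst n a b p q) * X p c * Y q d)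
      - (\<Sum>p\<in>{1..n}. \<Sum>q\<in>{1..n}. Y b q * X a p * scal (Rconst n p q c d)) = rttR X Y a b c d"
proof -
  have 1: "(\<Sum>p\<in>{1..n}. \<Sum>q\<in>{1..n}. scal (Rconst n a b p q) * X p c * Y q d)
      = scal (rr a b) * (X a c * Y b d) + scal (sw b a) * (X b c * Y a d)"
    unfolding mult.assoc by (rule R_sum) (use assms in \<open>simp_all add: Rconst_entry\<close>)
  have 2: "(\<Sum>p\<in>{1..n}. \<Sum>q\<in>{1..n}. Y b q * X a p * scal (Rconst n p q c d))
      = scal (rr c d) * (Y b d * X a c) + scal (sw c d) * (Y b c * X a d)"
    unfolding scal_central by (rule R_sum) (use assms in \<open>simp_all add: R_entry_right\<close>)
  show ?thesis
    unfolding 1 2 rttR_def by (simp only: diff_diff_eq)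
qed

lemma Rz_sums:
  assumes "{a, b, c, d} \<subseteq> {1..n}"
  shows "(\<Sum>p\<in>{1..n}. \<Sum>q\<in>{1..n}. scal (Rz n a b p q) * X p c * Y q d)
      - (\<Sum>p\<in>{1..n}. \<Sum>q\<in>{1..n}. Y b q * X a p * scal (Rz n p q c d)) = rttZ X Y a b c d"
proof -
  have 1: "(\<Sum>p\<in>{1..n}. \<Sum>q\<in>{1..n}. scal (Rz n a b p q) * X p c * Y q d)
      = scal (rho a b) * (X a c * Y b d) + scal (- sw a b) * (X b c * Y a d)"
    unfolding mult.assoc by (rule R_sum) (use assms in \<open>simp_all add: Rz_entry\<close>)
  have 2: "(\<Sum>p\<in>{1..n}. \<Sum>q\<in>{1..n}. Y b q * X a p * scal (Rz n p q c d))
      = scal (rho c d) * (Y b d * X a c) + scal (- sw d c) * (Y b c * X a d)"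
    unfolding scal_central by (rule R_sum) (use assms in \<open>simp_all add: R_entry_right\<close>)
  show ?thesis
    unfolding 1 2 rttZ_def by (simp add: scal_uminus)
qed

lemma frtt_eq:
  assumes "{a, b, c, d} \<subseteq> {1..n}"
  shows "frtt n e e' a b c d = rttR (fT e) (fT e') a b c d"
  unfolding frtt_def by (rule Rconst_sums[OF assms])

text \<open>The factor z of the trigonometric R-matrix raises the first exponent and the factor w
  the second, whence \<open>p - 1\<close> in one term and \<open>q - 1\<close> in the other.\<close>

lemma lrtt_eq:
  assumes "{a, b, c, d} \<subseteq> {1..n}"
  shows "lrtt n e e' a b c d p q = rttZ (\<lambda>i j. LT e i j (p - 1)) (\<lambda>i j. LT e' i j q) a b c d
    - rttR (\<lambda>i j. LT e i j p) (\<lambda>i j. LT e' i j (q - 1)) a b c d"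
  unfolding Rconst_sums[OF assms, symmetric] Rz_sums[OF assms, symmetric] lrtt_def
  by (simp add: Rw_eq scal_uminus sum.distrib sum_negf sum_subtractf)

context
  fixes a b c d :: nat
begin

lemma rtt_zero [simp]:
  "rttR (\<lambda>i j. 0) Y a b c d = 0" "rttR X (\<lambda>i j. 0) a b c d = 0"
  "rttZ (\<lambda>i j. 0) Y a b c d = 0" "rttZ X (\<lambda>i j. 0) a b c d = 0"
  by (simp_all add: rttR_def rttZ_def)

lemma rtt_minus [simp]:
  "rttR (\<lambda>i j. - X i j) Y a b c d = - rttR X Y a b c d"
  "rttR X (\<lambda>i j. - Y i j) a b c d = - rttR X Y a b c d"
  "rttZ (\<lambda>i j. - X i j) Y a b c d = - rttZ X Y a b c d"
  "rttZ X (\<lambda>i j. - Y i j) a b c d = - rttZ X Y a b c d"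
  by (simp_all add: rttR_def rttZ_def)

lemma rtt_add:
  "rttR (\<lambda>i j. X i j + X' i j) Y a b c d = rttR X Y a b c d + rttR X' Y a b c d"
  "rttZ (\<lambda>i j. X i j + X' i j) Y a b c d = rttZ X Y a b c d + rttZ X' Y a b c d"
  by (simp_all add: rttR_def rttZ_def algebra_simps)

lemma subst_rtt:
  "subst \<phi> (rttR X Y a b c d) = rttR (\<lambda>i j. subst \<phi> (X i j)) (\<lambda>i j. subst \<phi> (Y i j)) a b c d"
  "subst \<phi> (rttZ X Y a b c d) = rttZ (\<lambda>i j. subst \<phi> (X i j)) (\<lambda>i j. subst \<phi> (Y i j)) a b c d"
  by (simp_all add: rttR_def rttZ_def subst_simps)

text \<open>The Hecke relation \<open>R\<^sub>2\<^sub>1\<^sup>-\<^sup>1 = R - hP\<close>.\<close>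

lemma rttZ_rttR:
  "rttZ X Y a b c d = rttR X Y a b c d - scal hh * (X b c * Y a d) + scal hh * (Y b c * X a d)"
  unfolding rttZ_def rttR_def
  by (rule linorder_cases[of a b]; rule linorder_cases[of c d])
     (simp_all add: rr_def rho_def sw_def hh_def scal_diff algebra_simps)

text \<open>Conjugating \<open>R Y\<^sub>1 X\<^sub>2 = X\<^sub>2 Y\<^sub>1 R\<close> by the flip and multiplying by \<open>R\<^sub>2\<^sub>1\<^sup>-\<^sup>1\<close> on both sides.\<close>

lemma rttZ_flip:
  "rttZ X Y a b c d = scal (sw a b) *
       (scal (rho c d) * rttR Y X a b d c - scal (sw d c) * rttR Y X a b c d)
     - scal (rho a b) * (scal (rho c d) * rttR Y X b a d c - scal (sw d c) * rttR Y X b a c d)"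
\<comment> \<open>Taking coefficients turns a noncommutative identity into one over the field, with
  the coefficients of the products as unknowns.\<close>
proof (rule poly_mapping_eqI)
  fix w
  have v: "vv * (inverse vv * x) = x" "inverse vv * (vv * x) = x" for x
    by (simp_all add: mult.assoc[symmetric])
  show "lookup (rttZ X Y a b c d) w = lookup (scal (sw a b) *
       (scal (rho c d) * rttR Y X a b d c - scal (sw d c) * rttR Y X a b c d)
     - scal (rho a b) * (scal (rho c d) * rttR Y X b a d c - scal (sw d c) * rttR Y X b a c d)) w"
    unfolding rttZ_def rttR_def
    by (rule linorder_cases[of a b]; rule linorder_cases[of c d])
      (simp_all add: rr_def rho_def sw_def hh_def lookup_add lookup_minus ring_distribs v)
qed

end

section \<open>The kernel over \<open>\<complex>(v)\<close>\<close>

context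
  fixes n :: nat
begin

text \<open>\<open>FI\<close> presents the finite RTT algebra over the field, \<open>LI\<close> the
  quotient of the loop algebra by I: the generators of I join the defining relations.\<close>

definition FI :: "fgen free set" where "FI = ideal_gen UNIV (fgens n) (frels n)"
definition LI :: "lgen free set" where "LI = ideal_gen UNIV (lgens n) (lrels n \<union> Igens)"

lemma FI_closed:
  "0 \<in> FI"
  "x \<in> FI \<Longrightarrow> y \<in> FI \<Longrightarrow> x + y \<in> FI" "x \<in> FI \<Longrightarrow> y \<in> FI \<Longrightarrow> x - y \<in> FI"
  "x \<in> FI \<Longrightarrow> - x \<in> FI" "x \<in> FI \<Longrightarrow> scal c * x \<in> FI"
  unfolding FI_def
  by (simp_all add: ideal_gen.intros ideal_diff ideal_uminus ideal_scal scalar_ring_UNIV)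

lemma LI_closed:
  "0 \<in> LI"
  "x \<in> LI \<Longrightarrow> y \<in> LI \<Longrightarrow> x + y \<in> LI" "x \<in> LI \<Longrightarrow> y \<in> LI \<Longrightarrow> x - y \<in> LI"
  "x \<in> LI \<Longrightarrow> - x \<in> LI" "x \<in> LI \<Longrightarrow> scal c * x \<in> LI"
  unfolding LI_def
  by (simp_all add: ideal_gen.intros ideal_diff ideal_uminus ideal_scal scalar_ring_UNIV)

lemma FI_base: "s \<in> frels n \<Longrightarrow> s \<in> FI"
  unfolding FI_def by (simp add: ideal_base scalar_ring_UNIV)

lemma LI_base: "s \<in> lrels n \<union> Igens \<Longrightarrow> s \<in> LI"
  unfolding LI_def by (simp add: ideal_base scalar_ring_UNIV)

lemma frels_intros:
  "i \<in> {1..n} \<Longrightarrow> gen (TP i i) * gen (TM i i) - 1 \<in> frels n"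
  "i \<in> {1..n} \<Longrightarrow> gen (TM i i) * gen (TP i i) - 1 \<in> frels n"
  "i \<in> {1..n} \<Longrightarrow> j \<in> {1..n} \<Longrightarrow> j < i \<Longrightarrow> gen (TP i j) \<in> frels n"
  "i \<in> {1..n} \<Longrightarrow> j \<in> {1..n} \<Longrightarrow> j < i \<Longrightarrow> gen (TM j i) \<in> frels n"
  "(e, e') \<in> {(True, True), (False, False), (False, True)} \<Longrightarrow> {a, b, c, d} \<subseteq> {1..n} \<Longrightarrow>
     frtt n e e' a b c d \<in> frels n"
  unfolding frels_def by blast+

lemma lrels_intros:
  "i \<in> {1..n} \<Longrightarrow> gen (LTP i i 0) * gen (LTM i i 0) - 1 \<in> lrels n"
  "i \<in> {1..n} \<Longrightarrow> gen (LTM i i 0) * gen (LTP i i 0) - 1 \<in> lrels n"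
  "i \<in> {1..n} \<Longrightarrow> j \<in> {1..n} \<Longrightarrow> j < i \<Longrightarrow> gen (LTP i j 0) \<in> lrels n"
  "i \<in> {1..n} \<Longrightarrow> j \<in> {1..n} \<Longrightarrow> j < i \<Longrightarrow> gen (LTM j i 0) \<in> lrels n"
  "(e, e') \<in> {(True, True), (False, False), (False, True)} \<Longrightarrow> {a, b, c, d} \<subseteq> {1..n} \<Longrightarrow>
     lrtt n e e' a b c d p q \<in> lrels n"
  unfolding lrels_def by blast+

lemma FI_rttR:
  assumes "(e, e') \<in> {(True, True), (False, False), (False, True)}" "{a, b, c, d} \<subseteq> {1..n}"
  shows "rttR (fT e) (fT e') a b c d \<in> FI"
  unfolding frtt_eq[OF assms(2), symmetric] by (intro FI_base frels_intros assms)

text \<open>For equal arguments the two \<open>hh\<close> terms of the Hecke relation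
  cancel.\<close>

lemma FI_rttZ_diag:
  assumes "{a, b, c, d} \<subseteq> {1..n}"
  shows "rttZ (fT e) (fT e) a b c d \<in> FI"
  using FI_rttR[of e e, OF _ assms] by (cases e) (simp_all add: rttZ_rttR)

text \<open>The given mixed relation has \<open>T^-\<close> first; the flip supplies the opposite
  order, with the companion matrix in place of \<open>R\<close>.\<close>

lemma FI_rttZ_mixed:
  assumes "{a, b, c, d} \<subseteq> {1..n}"
  shows "rttZ (fT True) (fT False) a b c d \<in> FI"
  unfolding rttZ_flip using assms by (intro FI_closed FI_rttR) auto

section \<open>The evaluation map on the loop relations\<close>

definition evT :: "int \<Rightarrow> nat \<Rightarrow> nat \<Rightarrow> fgen free" where
  "evT p i j = (if p = 0 then fT True i j else if p = -1 then - fT False i j else 0)"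

text \<open>\<open>evT\<close> lists the coefficients of the image \<open>T^+ - T^- z^{-1}\<close>
  of \<open>T^+(z)\<close>; the image of \<open>T^-(z)\<close> is -z times this series, so one
  family covers both signs.\<close>

lemma subst_LT: "subst evgen (LT e i j p) = (if e then evT p i j else - evT (p - 1) i j)"
  by (auto simp: LT_def evT_def fT_def)

lemma evT_eq:
  "evT p = (if p = 0 then fT True else if p = -1 then (\<lambda>i j. - fT False i j) else (\<lambda>i j. 0))"
  by (intro ext) (simp add: evT_def)

lemma evT_rtt:
  assumes "{a, b, c, d} \<subseteq> {1..n}"
  shows "rttZ (evT (p - 1)) (evT q) a b c d - rttR (evT p) (evT (q - 1)) a b c d \<in> FI"
proof -
  \<comment> \<open>Only at \<open>p = q = 0\<close> do both terms survive. By the Hecke relation,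
    trading \<open>rttR\<close> for \<open>rttZ\<close> in one and \<open>rttZ\<close> for
    \<open>rttR\<close> in the other introduces the same correction, so their difference reduces to
    two known relations.\<close>
  have "rttZ (fT True) (fT False) a b c d - rttR (fT False) (fT True) a b c d \<in> FI"
    using assms by (intro FI_closed FI_rttZ_mixed FI_rttR) auto
  then have const: "rttR (fT True) (fT False) a b c d - rttZ (fT False) (fT True) a b c d \<in> FI"
    unfolding rttZ_rttR by (simp add: algebra_simps)
  consider "p = 1" | "p = 0" | "p = -1" | "p \<notin> {1, 0, -1}"
    by auto
  then show ?thesis
  proof cases
    case 1
    then show ?thesis
      by (cases "q = 1"; cases "q = 0"; cases "q = -1") (use const assms in \<open>auto simp: evT_eq
          intro!: FI_closed FI_rttR FI_rttZ_diag FI_rttZ_mixed\<close>)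
  next
    case 2
    then show ?thesis
      by (cases "q = 1"; cases "q = 0"; cases "q = -1") (use const assms in \<open>auto simp: evT_eq
          intro!: FI_closed FI_rttR FI_rttZ_diag FI_rttZ_mixed\<close>)
  next
    case 3
    then show ?thesis
      by (cases "q = 1"; cases "q = 0"; cases "q = -1") (use const assms in \<open>auto simp: evT_eq
          intro!: FI_closed FI_rttR FI_rttZ_diag FI_rttZ_mixed\<close>)
  next
    case 4
    then have "evT p = (\<lambda>i j. 0)" "evT (p - 1) = (\<lambda>i j. 0)"
      by (auto simp: evT_eq)
    then show ?thesis
      by (simp add: FI_closed)
  qed
qed

lemma subst_lrtt_FI:
  assumes "{a, b, c, d} \<subseteq> {1..n}"
  shows "subst evgen (lrtt n e e' a b c d p q) \<in> FI"
proof -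
  \<comment> \<open>The shifts absorb the powers of z and w relating the image of \<open>T^-\<close>
    to that of \<open>T^+\<close>; the factors -1 leave a sign when \<open>e\<close> and
    \<open>e'\<close> differ.\<close>
  define p' q' where "p' = (if e then p else p - 1)" and "q' = (if e' then q else q - 1)"
  have "subst evgen (lrtt n e e' a b c d p q)
      = (if e = e' then 1 else -1) *
        (rttZ (evT (p' - 1)) (evT q') a b c d - rttR (evT p') (evT (q' - 1)) a b c d)"
    unfolding lrtt_eq[OF assms] subst_diff subst_rtt subst_LT p'_def q'_def
    by (cases e; cases e') (simp_all add: rtt_minus)
  then show ?thesis
    using evT_rtt[OF assms, of p' q'] FI_closed(4)[OF evT_rtt[OF assms, of p' q']]
    by (cases "e = e'") simp_all
qed

text \<open>One inclusion over the field. The generators of I even evaluate to zero in the free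
  algebra.\<close>

lemma subst_LI_FI:
  assumes "x \<in> LI" "n \<ge> 1"
  shows "subst evgen x \<in> FI"
  unfolding FI_def
proof (rule subst_ideal[OF scalar_ring_UNIV])
  show "x \<in> ideal_gen UNIV (lgens n) (lrels n \<union> Igens)"
    using assms(1) by (simp add: LI_def)
next
  fix g assume "g \<in> lgens n"
  then show "evgen g \<in> free_over UNIV (fgens n)"
    by (auto simp: lgens_def fgens_def gen_eq_mon free_over_zero free_over_uminus free_over_mon
        scalar_ring_UNIV)
next
  fix s assume "s \<in> lrels n \<union> Igens"
  then have "subst evgen s \<in> FI"
    unfolding lrels_def
  proof (elim UnE CollectE exE conjE, goal_cases)
    case (1 i)
    then show ?case
      by (simp add: subst_simps FI_base frels_intros)
  next
    case (2 i)
    then show ?case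
      by (simp add: subst_simps FI_base frels_intros)
  next
    case (3 i j)
    then show ?case
      by (simp add: subst_simps FI_base frels_intros)
  next
    case (4 i j)
    then show ?case
      by (simp add: subst_simps FI_base frels_intros)
  next
    case 5
    then show ?case
      by (simp add: subst_lrtt_FI)
  next
    case 6
    then have "subst evgen s = 0"
      by (auto simp: Igens_def subst_simps)
    then show ?case
      by (simp add: FI_closed)
  qed
  then show "subst evgen s \<in> ideal_gen UNIV (fgens n) (frels n)"
    by (simp add: FI_def)
qed

text \<open>The coefficients of \<open>T\<^sup>-(z) + z T\<^sup>+(z)\<close>; the ideal \<open>LI\<close> kills them all because it kills
  those at position \<open>(1,1)\<close>.\<close>

definition CT :: "int \<Rightarrow> nat \<Rightarrow> nat \<Rightarrow> lgen free" where
  "CT p i j = LT False i j p + LT True i j (p - 1)"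

section \<open>Vanishing of all entries of C(z) modulo I\<close>

lemma CT_rtt:
  assumes "{a, b, c, d} \<subseteq> {1..n}"
  shows "rttZ (CT (p - 1)) (\<lambda>i j. LT True i j q) a b c d
    - rttR (CT p) (\<lambda>i j. LT True i j (q - 1)) a b c d \<in> LI"
proof -
  \<comment> \<open>Multiplying the relation for the signs (+,+) by z shifts its coefficient to
    \<open>p - 1\<close>; adding the one for (-,+) gives the relation for C(z).\<close>
  have "lrtt n False True a b c d p q + lrtt n True True a b c d (p - 1) q \<in> LI"
    by (intro LI_closed(2) LI_base UnI1 lrels_intros(5) assms) simp_all
  then show ?thesis
    unfolding lrtt_eq[OF assms] CT_def[abs_def] rtt_add by (simp add: algebra_simps)
qed

lemma LT_free: "i \<in> {1..n} \<Longrightarrow> j \<in> {1..n} \<Longrightarrow> LT e i j p \<in> free_over UNIV (lgens n)"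
  by (auto simp: LT_def gen_eq_mon lgens_def free_over_zero free_over_mon scalar_ring_UNIV)

lemma LI_mult:
  "x \<in> LI \<Longrightarrow> y \<in> free_over UNIV (lgens n) \<Longrightarrow> y * x \<in> LI"
  "x \<in> LI \<Longrightarrow> y \<in> free_over UNIV (lgens n) \<Longrightarrow> x * y \<in> LI"
  unfolding LI_def by (simp_all add: ideal_mult_left ideal_mult_right scalar_ring_UNIV)

lemma CT_free: "i \<in> {1..n} \<Longrightarrow> j \<in> {1..n} \<Longrightarrow> CT p i j \<in> free_over UNIV (lgens n)"
  unfolding CT_def by (simp add: free_over_add scalar_ring_UNIV LT_free)

text \<open>The coefficients at 0 and 1 are the two binomial generators of I, all others are the
  single ones.\<close>

lemma CT_11: "CT p 1 1 \<in> LI"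
proof -
  consider "p \<ge> 2" | "p = 1" | "p = 0" | "p < 0"
    by linarith
  then show ?thesis
  proof cases
    case 1
    then have "CT p 1 1 = gen (LTM 1 1 (nat p))" "nat p \<ge> 2"
      by (auto simp: CT_def LT_def)
    then show ?thesis
      by (intro LI_base) (auto simp: Igens_def)
  next
    case 2
    then have "CT p 1 1 = gen (LTM 1 1 1) + gen (LTP 1 1 0)"
      by (auto simp: CT_def LT_def)
    then show ?thesis
      by (intro LI_base) (auto simp: Igens_def)
  next
    case 3
    then have "CT p 1 1 = gen (LTP 1 1 1) + gen (LTM 1 1 0)"
      by (auto simp: CT_def LT_def add.commute)
    then show ?thesis
      by (intro LI_base) (auto simp: Igens_def)
  next
    case 4
    then have "CT p 1 1 = gen (LTP 1 1 (nat (1 - p)))" "nat (1 - p) \<ge> 2"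
      by (auto simp: CT_def LT_def)
    then show ?thesis
      by (intro LI_base) (auto simp: Igens_def)
  qed
qed

text \<open>Permits division by \<open>hh\<close> over the field; \<open>hh\<close> is not a unit of
  \<open>Laur\<close>.\<close>

lemma hh_nonzero: "hh \<noteq> 0"
proof
  assume "hh = 0"
  then have "vv * vv = 1"
    by (simp add: hh_def) (metis vv_nonzero right_inverse)
  then have "[:0, 1:] * [:0, 1:] = (1 :: complex poly)"
    by (simp add: vv_def eq_fract One_fract_def)
  then show False
    by (simp add: one_pCons)
qed

lemma LI_cancel_scal: "scal c * x \<in> LI \<Longrightarrow> c \<noteq> 0 \<Longrightarrow> x \<in> LI"
  using LI_closed(5)[of "scal c * x" "inverse c"] by (simp add: scal_scal)

text \<open>Modulo \<open>LI\<close> the zero mode \<open>LTP 1 1 0\<close> is invertible, with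
  inverse \<open>LTM 1 1 0\<close>.\<close>

lemma LI_cancel_left:
  assumes "gen (LTP 1 1 0) * x \<in> LI" "x \<in> free_over UNIV (lgens n)" "n \<ge> 1"
  shows "x \<in> LI"
proof -
  have "gen (LTM 1 1 0) \<in> free_over UNIV (lgens n)"
    using LT_free[of 1 1 False 0] assms(3) by (simp add: LT_def)
  then have "gen (LTM 1 1 0) * (gen (LTP 1 1 0) * x) \<in> LI"
    by (rule LI_mult(1)[OF assms(1)])
  moreover have "(gen (LTM 1 1 0) * gen (LTP 1 1 0) - 1) * x \<in> LI"
    by (rule LI_mult(2)[OF LI_base assms(2)]) (use assms(3) in \<open>auto intro!: lrels_intros\<close>)
  ultimately have "gen (LTM 1 1 0) * (gen (LTP 1 1 0) * x)
      - (gen (LTM 1 1 0) * gen (LTP 1 1 0) - 1) * x \<in> LI"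
    by (rule LI_closed(3))
  then show ?thesis
    by (simp add: algebra_simps)
qed

lemma LI_cancel_right:
  assumes "x * gen (LTP 1 1 0) \<in> LI" "x \<in> free_over UNIV (lgens n)" "n \<ge> 1"
  shows "x \<in> LI"
proof -
  have "gen (LTM 1 1 0) \<in> free_over UNIV (lgens n)"
    using LT_free[of 1 1 False 0] assms(3) by (simp add: LT_def)
  then have "x * gen (LTP 1 1 0) * gen (LTM 1 1 0) \<in> LI"
    by (rule LI_mult(2)[OF assms(1)])
  moreover have "x * (gen (LTP 1 1 0) * gen (LTM 1 1 0) - 1) \<in> LI"
    by (rule LI_mult(1)[OF LI_base assms(2)]) (use assms(3) in \<open>auto intro!: lrels_intros\<close>)
  ultimately have "x * gen (LTP 1 1 0) * gen (LTM 1 1 0)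
      - x * (gen (LTP 1 1 0) * gen (LTM 1 1 0) - 1) \<in> LI"
    by (rule LI_closed(3))
  then show ?thesis
    by (simp add: algebra_simps)
qed

lemma CT_11_mult:
  "y \<in> free_over UNIV (lgens n) \<Longrightarrow> CT p 1 1 * y \<in> LI"
  "y \<in> free_over UNIV (lgens n) \<Longrightarrow> y * CT p 1 1 \<in> LI"
  by (simp_all only: LI_mult CT_11)

lemma CT_first_row:
  assumes "d \<in> {1..n}"
  shows "CT p 1 d \<in> LI"
proof (cases "d = 1")
  case False
  with assms have d: "1 < d" "1 \<in> {1..n}" "n \<ge> 1"
    by auto
  let ?A = "\<lambda>q i j. LT True i j q"
  \<comment> \<open>At the power w^1 the \<open>rttZ\<close> term is zero, since
    \<open>T^+(w)\<close> has no positive powers. In the other term everything but \<open>hh\<close>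
    times the product of \<open>LTP 1 1 0\<close> and \<open>CT p 1 d\<close> contains an entry of
    C(z) at (1,1).\<close>
  have "rttZ (CT (p - 1)) (?A 1) 1 1 1 d - rttR (CT p) (?A (1 - 1)) 1 1 1 d
      - (scal vv * (CT (p - 1) 1 1 * ?A 1 1 d) - ?A 1 1 d * CT (p - 1) 1 1)
      + (scal (inverse vv) * (CT p 1 1 * ?A 0 1 d) - ?A 0 1 d * CT p 1 1) \<in> LI"
    using d assms by (intro LI_closed CT_rtt CT_11_mult LT_free) auto
  also have "rttZ (CT (p - 1)) (?A 1) 1 1 1 d - rttR (CT p) (?A (1 - 1)) 1 1 1 d
      - (scal vv * (CT (p - 1) 1 1 * ?A 1 1 d) - ?A 1 1 d * CT (p - 1) 1 1)
      + (scal (inverse vv) * (CT p 1 1 * ?A 0 1 d) - ?A 0 1 d * CT p 1 1)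
      = scal hh * (gen (LTP 1 1 0) * CT p 1 d)"
    using d by (simp add: rttZ_def rttR_def rho_def rr_def sw_def) (simp add: LT_def)
  finally show ?thesis
    by (rule LI_cancel_left[OF LI_cancel_scal]) (use assms d hh_nonzero CT_free in auto)
qed (use CT_11 in simp)

lemma CT_first_row_mult:
  "c \<in> {1..n} \<Longrightarrow> y \<in> free_over UNIV (lgens n) \<Longrightarrow> CT p 1 c * y \<in> LI"
  "c \<in> {1..n} \<Longrightarrow> y \<in> free_over UNIV (lgens n) \<Longrightarrow> y * CT p 1 c \<in> LI"
  by (simp_all only: LI_mult CT_first_row)

lemma CT_LI:
  assumes "b \<in> {1..n}" "c \<in> {1..n}"
  shows "CT p b c \<in> LI"
proof (cases "b = 1")
  case False
  with assms have b: "1 < b" "1 \<in> {1..n}" "n \<ge> 1"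
    by auto
  let ?A = "\<lambda>q i j. LT True i j q"
  \<comment> \<open>In this position the flip entry of the companion matrix produces
    \<open>CT p b c\<close> next to the zero mode, with coefficient \<open>- hh\<close>; every other
    nonzero product contains an entry of the first row of C(z).\<close>
  have "rttZ (CT p) (?A 0) 1 b c 1 - rttR (CT (p + 1)) (?A (-1)) 1 b c 1 \<in> LI"
    using assms b CT_rtt[of 1 b c 1 "p + 1" 0] by simp
  then have "rttZ (CT p) (?A 0) 1 b c 1 - rttR (CT (p + 1)) (?A (-1)) 1 b c 1
      - (scal 1 * (CT p 1 c * ?A 0 b 1) - scal (rho c 1) * (?A 0 b 1 * CT p 1 c)
         + scal (sw 1 c) * (?A 0 b c * CT p 1 1))
      + (scal 1 * (CT (p + 1) 1 c * ?A (-1) b 1)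
         - scal (rr c 1) * (?A (-1) b 1 * CT (p + 1) 1 c)) \<in> LI"
    by (rule LI_closed(2)[OF LI_closed(3)])
       (intro LI_closed(2,3,5) CT_first_row_mult LT_free; use assms b in auto)+
  also have "rttZ (CT p) (?A 0) 1 b c 1 - rttR (CT (p + 1)) (?A (-1)) 1 b c 1
      - (scal 1 * (CT p 1 c * ?A 0 b 1) - scal (rho c 1) * (?A 0 b 1 * CT p 1 c)
         + scal (sw 1 c) * (?A 0 b c * CT p 1 1))
      + (scal 1 * (CT (p + 1) 1 c * ?A (-1) b 1)
         - scal (rr c 1) * (?A (-1) b 1 * CT (p + 1) 1 c))
      = scal (- hh) * (CT p b c * gen (LTP 1 1 0))"
    using b assms by (simp add: rttZ_def rttR_def rho_def[of "Suc 0"] rr_def[of "Suc 0"] sw_def scal_uminus)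
      (simp add: LT_def)
  finally show ?thesis
    by (rule LI_cancel_right[OF LI_cancel_scal]) (use assms b hh_nonzero CT_free in auto)
qed (use assms CT_first_row in simp)

section \<open>The inverse of evaluation on zero modes\<close>

fun zeromode :: "fgen \<Rightarrow> lgen free" where
  "zeromode (TP i j) = gen (LTP i j 0)"
| "zeromode (TM i j) = gen (LTM i j 0)"

lemma zeromode_free: "g \<in> fgens n \<Longrightarrow> zeromode g \<in> free_over UNIV (lgens n)"
  by (auto simp: fgens_def gen_eq_mon lgens_def free_over_mon scalar_ring_UNIV)

lemma subst_zeromode_LI:
  assumes "x \<in> FI"
  shows "subst zeromode x \<in> LI"
  unfolding LI_def
proof (rule subst_ideal[OF scalar_ring_UNIV])
  show "x \<in> ideal_gen UNIV (fgens n) (frels n)"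
    using assms(1) by (simp add: FI_def)
next
  fix s assume "s \<in> frels n"
  then have "subst zeromode s \<in> LI"
    unfolding frels_def
  proof (elim UnE CollectE exE conjE, goal_cases)
    case (1 i)
    then show ?case
      by (simp add: subst_simps LI_base lrels_intros)
  next
    case (2 i)
    then show ?case
      by (simp add: subst_simps LI_base lrels_intros)
  next
    case (3 i j)
    then show ?case
      by (simp add: subst_simps LI_base lrels_intros)
  next
    case (4 i j)
    then show ?case
      by (simp add: subst_simps LI_base lrels_intros)
  next
    case (5 e e' a b c d)
    have "subst zeromode (fT e i j) = LT e i j 0" for e i j
      by (simp add: fT_def LT_def)
    then have "subst zeromode s = rttR (\<lambda>i j. LT e i j 0) (\<lambda>i j. LT e' i j 0) a b c d"
      using 5 by (simp add: frtt_eq subst_rtt)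
    also have "\<dots> = - lrtt n e e' a b c d 0 1"
      using 5(2) unfolding lrtt_eq[OF 5(3)] by (auto simp: LT_def)
    also have "\<dots> \<in> LI"
      using 5 by (intro LI_closed(4) LI_base UnI1 lrels_intros)
    finally show ?case .
  qed
  then show "subst zeromode s \<in> ideal_gen UNIV (lgens n) (lrels n \<union> Igens)"
    by (simp add: LI_def)
qed (rule zeromode_free)

lemma evgen_free: "scalar_ring C \<Longrightarrow> g \<in> lgens n \<Longrightarrow> evgen g \<in> free_over C (fgens n)"
  by (auto simp: lgens_def fgens_def gen_eq_mon free_over_zero free_over_uminus free_over_mon)

text \<open>On a generator the difference is zero or a coefficient of C(z), and the congruence
  extends from generators to all elements.\<close>

lemma zeromode_evgen_LI:
  assumes "f \<in> free_over UNIV (lgens n)"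
  shows "f - subst zeromode (subst evgen f) \<in> LI"
proof -
  have "subst zeromode (subst evgen f) = subst (\<lambda>g. subst zeromode (evgen g)) f"
  proof (induction f rule: free_induct)
    case (step c w f)
    have "subst zeromode (prod_list (map evgen xs)) = prod_list (map (\<lambda>g. subst zeromode (evgen g)) xs)" for xs
      by (induction xs) (simp_all add: subst_mult)
    with step show ?case
      by (simp only: subst_add subst_mult subst_scal subst_mon)
  qed simp
  moreover have "f - subst (\<lambda>g. subst zeromode (evgen g)) f \<in> LI"
    unfolding LI_def
  proof (rule subst_cong_ideal[OF scalar_ring_UNIV assms])
    fix g assume g: "g \<in> lgens n"
    then show "subst zeromode (evgen g) \<in> free_over UNIV (lgens n)"
      by (rule free_over_subst[OF scalar_ring_UNIV evgen_free[OF scalar_ring_UNIV] zeromode_free])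
    from g consider (P) i j r where "i \<in> {1..n}" "j \<in> {1..n}" "g = LTP i j r"
      | (M) i j r where "i \<in> {1..n}" "j \<in> {1..n}" "g = LTM i j r"
      by (auto simp: lgens_def)
    then have "gen g - subst zeromode (evgen g) \<in> LI"
    proof cases
      case P
      then have "gen g - subst zeromode (evgen g) = (if r = 0 then 0 else CT (1 - int r) i j)"
        by (auto simp: CT_def LT_def subst_simps add.commute)
      with P show ?thesis
        by (simp add: CT_LI LI_closed)
    next
      case M
      then have "gen g - subst zeromode (evgen g) = (if r = 0 then 0 else CT (int r) i j)"
        by (auto simp: CT_def LT_def subst_simps)
      with M show ?thesis
        by (simp add: CT_LI LI_closed)
    qed
    then show "gen g - subst zeromode (evgen g) \<in> ideal_gen UNIV (lgens n) (lrels n \<union> Igens)"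
      by (simp add: LI_def)
  qed
  ultimately show ?thesis
    by simp
qed

text \<open>Since \<open>zeromode\<close> undoes evaluation modulo \<open>LI\<close>, an element
  that evaluates into \<open>FI\<close> is congruent to an element of \<open>LI\<close>.\<close>

lemma kernel_over_field:
  assumes "n \<ge> 1" "f \<in> free_over UNIV (lgens n)"
  shows "subst evgen f \<in> FI \<longleftrightarrow> f \<in> LI"
proof
  assume "subst evgen f \<in> FI"
  then have "f - subst zeromode (subst evgen f) + subst zeromode (subst evgen f) \<in> LI"
    using assms by (intro LI_closed zeromode_evgen_LI subst_zeromode_LI)
  then show "f \<in> LI"
    by simp
qed (use assms subst_LI_FI in auto)

end

section \<open>Normal words span the integral form\<close>

abbreviation lt :: "bool \<Rightarrow> nat \<Rightarrow> nat \<Rightarrow> fgen" where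
  "lt e i j \<equiv> (if e then TP i j else TM i j)"

definition valid :: "bool \<Rightarrow> nat \<Rightarrow> nat \<Rightarrow> bool" where
  "valid e i j \<longleftrightarrow> (if e then i \<le> j else j \<le> i)"

text \<open>Diagonal generators come first, with the mutually inverse \<open>TP i i\<close> and
  \<open>TM i i\<close> adjacent; the off-diagonal ones follow from \<open>2 * n + 2\<close> on, and
  parity tells \<open>TP\<close> from \<open>TM\<close>.\<close>

fun key :: "nat \<Rightarrow> fgen \<Rightarrow> nat" where
  "key n (TP i j) = (if i = j then 2 * i else 2 * n + 2 + 2 * prod_encode (i, j))"
| "key n (TM i j) = (if i = j then 2 * i + 1 else 2 * n + 3 + 2 * prod_encode (i, j))"

lemma fgens_cases:
  assumes "g \<in> fgens n"
  obtains e i j where "g = lt e i j" "i \<in> {1..n}" "j \<in> {1..n}"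
proof -
  from assms consider i j where "g = TP i j" "i \<in> {1..n}" "j \<in> {1..n}"
    | i j where "g = TM i j" "i \<in> {1..n}" "j \<in> {1..n}"
    by (auto simp: fgens_def)
  then show ?thesis
    using that[of True] that[of False] by cases auto
qed

lemma lt_fgens: "i \<in> {1..n} \<Longrightarrow> j \<in> {1..n} \<Longrightarrow> lt e i j \<in> fgens n"
  by (auto simp: fgens_def)

lemma key_inj: "inj_on (key n) (fgens n)"
proof (rule inj_onI)
  fix g h assume g: "g \<in> fgens n" and h: "h \<in> fgens n" and eq: "key n g = key n h"
  from g obtain e i j where ij: "g = lt e i j" "i \<in> {1..n}" "j \<in> {1..n}"
    by (rule fgens_cases)
  from h obtain e' i' j' where ij': "h = lt e' i' j'" "i' \<in> {1..n}" "j' \<in> {1..n}"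
    by (rule fgens_cases)
  have odd: "2 * x + 1 \<noteq> 2 * y" "2 * n + 3 + 2 * x \<noteq> 2 * n + 2 + 2 * y"
    "2 * n + 3 + 2 * x \<noteq> 2 * y" "2 * n + 2 + 2 * x \<noteq> 2 * y + 1" for x y :: nat
    by presburger+
  show "g = h"
    using eq ij ij' odd odd[symmetric]
    by (cases e; cases e'; cases "i = j"; cases "i' = j'") auto
qed

text \<open>Every correction term arising when two generators are exchanged has smaller degree, because
  \<open>x \<mapsto> x (2 n - x)\<close> is strictly increasing and strictly concave on \<open>{0..n}\<close>.\<close>

definition dg :: "nat \<Rightarrow> nat \<Rightarrow> nat" where
  "dg n x = x * (2 * n - x)"

lemma dg_0 [simp]: "dg n 0 = 0"
  by (simp add: dg_def)

lemma int_dg: "x \<le> n \<Longrightarrow> int (dg n x) = int x * (2 * int n - int x)"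
  by (simp add: dg_def of_nat_diff)

lemma dg_mono:
  assumes "x < y" "y \<le> n"
  shows "dg n x < dg n y"
proof -
  have "int (dg n y) - int (dg n x) = (int y - int x) * (2 * int n - int x - int y)"
    using assms by (simp add: int_dg algebra_simps)
  also have "\<dots> > 0"
    using assms by (intro mult_pos_pos) auto
  finally show ?thesis
    by simp
qed

lemma dg_concave:
  assumes "p > 0" "q > 0" "x + p + q \<le> n"
  shows "dg n x + dg n (x + p + q) < dg n (x + p) + dg n (x + q)"
proof -
  have "int (dg n (x + p) + dg n (x + q)) - int (dg n x + dg n (x + p + q)) = 2 * int p * int q"
    using assms by (simp add: int_dg algebra_simps)
  also have "\<dots> > 0"
    using assms by simp
  finally show ?thesis
    by linarith
qed

fun deg :: "nat \<Rightarrow> fgen \<Rightarrow> nat" where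
  "deg n (TP i j) = dg n (j - i)"
| "deg n (TM i j) = dg n (i - j)"

text \<open>The lengths of the two index intervals keep their sum but move apart, so strict
  concavity lowers the total degree.\<close>

lemma deg_diagonal:
  assumes "valid e b c" "valid e a d" "a < b \<and> c < d \<or> b < a \<and> d < c"
    "{a, b, c, d} \<subseteq> {1..n}"
  shows "deg n (lt e b c) + deg n (lt e a d) < deg n (lt e a c) + deg n (lt e b d)"
proof (cases e)
  have sub: "x \<le> n \<Longrightarrow> x - y \<le> n" for x y :: nat
    by linarith
  case True
  from assms(3) show ?thesis
  proof
    assume "a < b \<and> c < d"
    then show ?thesis
      using dg_concave[of "b - a" "d - c" "c - b" n] assms True by (auto simp: valid_def sub add.commute)
  next
    assume "b < a \<and> d < c"
    then show ?thesis
      using dg_concave[of "a - b" "c - d" "d - a" n] assms True by (auto simp: valid_def sub add.commute)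
  qed
next
  have sub: "x \<le> n \<Longrightarrow> x - y \<le> n" for x y :: nat
    by linarith
  case False
  from assms(3) show ?thesis
  proof
    assume "a < b \<and> c < d"
    then show ?thesis
      using dg_concave[of "b - a" "d - c" "a - d" n] assms False by (auto simp: valid_def sub add.commute)
  next
    assume "b < a \<and> d < c"
    then show ?thesis
      using dg_concave[of "a - b" "c - d" "b - c" n] assms False by (auto simp: valid_def sub add.commute)
  qed
qed

context
  fixes n :: nat
begin

section \<open>Exchanging two generators up to terms of lower degree\<close>

definition FL :: "fgen free set" where "FL = ideal_gen Laur (fgens n) (frels n)"

lemma FL_closed:
  "0 \<in> FL"
  "x \<in> FL \<Longrightarrow> y \<in> FL \<Longrightarrow> x + y \<in> FL" "x \<in> FL \<Longrightarrow> y \<in> FL \<Longrightarrow> x - y \<in> FL"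
  "x \<in> FL \<Longrightarrow> - x \<in> FL" "x \<in> FL \<Longrightarrow> c \<in> Laur \<Longrightarrow> scal c * x \<in> FL"
  unfolding FL_def
  by (simp_all add: ideal_gen.intros ideal_diff ideal_uminus ideal_scal scalar_ring_Laur)

lemma FL_base: "s \<in> frels n \<Longrightarrow> s \<in> FL"
  unfolding FL_def by (simp add: ideal_base scalar_ring_Laur)

lemma FL_mon:
  "x \<in> FL \<Longrightarrow> set xs \<subseteq> fgens n \<Longrightarrow> mon (Word xs) * x \<in> FL"
  "x \<in> FL \<Longrightarrow> set xs \<subseteq> fgens n \<Longrightarrow> x * mon (Word xs) \<in> FL"
  unfolding FL_def by (simp_all add: ideal_mon_left ideal_mon_right scalar_ring_Laur)

lemma FL_rttR:
  assumes "(e, e') \<in> {(True, True), (False, False), (False, True)}" "{a, b, c, d} \<subseteq> {1..n}"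
  shows "rttR (fT e) (fT e') a b c d \<in> FL"
  unfolding frtt_eq[OF assms(2), symmetric] by (intro FL_base frels_intros assms)

lemma FL_invalid:
  assumes "\<not> valid e i j" "i \<in> {1..n}" "j \<in> {1..n}"
  shows "gen (lt e i j) \<in> FL"
  using assms by (cases e) (auto simp: valid_def intro!: FL_base frels_intros)

inductive_set low :: "nat \<Rightarrow> fgen free set" for D where
  ideal: "x \<in> FL \<Longrightarrow> x \<in> low D"
| add: "x \<in> low D \<Longrightarrow> y \<in> low D \<Longrightarrow> x + y \<in> low D"
| prod: "g \<in> fgens n \<Longrightarrow> h \<in> fgens n \<Longrightarrow> c \<in> Laur \<Longrightarrow> deg n g + deg n h < D \<Longrightarrow>
    scal c * (gen g * gen h) \<in> low D"

lemma low_scal: "x \<in> low D \<Longrightarrow> c \<in> Laur \<Longrightarrow> scal c * x \<in> low D"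
  by (induction rule: low.induct)
     (auto simp: distrib_left scal_scal C_mult[OF scalar_ring_Laur] FL_closed intro: low.intros)

lemma low_uminus: "x \<in> low D \<Longrightarrow> - x \<in> low D"
  using low_scal[of x D "-1"] by (simp add: scal_uminus C_uminus C_one scalar_ring_Laur)

lemma low_diff: "x \<in> low D \<Longrightarrow> y \<in> low D \<Longrightarrow> x - y \<in> low D"
  using low.add[of x D "- y"] low_uminus[of y] by simp

text \<open>A product with a generator that vanishes by triangularity is already in the ideal, so
  degrees are compared for valid factors only.\<close>

lemma low_prod:
  assumes "valid e i j \<Longrightarrow> valid e' k l \<Longrightarrow> deg n (lt e i j) + deg n (lt e' k l) < D"
    and "{i, j, k, l} \<subseteq> {1..n}" "c \<in> Laur"
  shows "scal c * (fT e i j * fT e' k l) \<in> low D"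
proof (cases "valid e i j \<and> valid e' k l")
  case True
  with assms show ?thesis
    unfolding fT_def by (intro low.prod lt_fgens) auto
next
  case False
  have "fT e i j * fT e' k l \<in> FL"
  proof (cases "valid e i j")
    case True
    with False assms FL_mon(1)[OF FL_invalid, of e' k l "[lt e i j]"] show ?thesis
      by (simp add: fT_def flip: gen_eq_mon) (auto simp: fgens_def)
  next
    case False
    with assms FL_mon(2)[OF FL_invalid, of e i j "[lt e' k l]"] show ?thesis
      by (simp add: fT_def flip: gen_eq_mon) (auto simp: fgens_def)
  qed
  with assms(3) show ?thesis
    by (intro low.ideal FL_closed)
qed

lemma hh_Laur: "hh \<in> Laur"
  unfolding hh_def by (intro C_diff[OF scalar_ring_Laur] vv_Laur inverse_vv_Laur)

lemma sw_Laur: "sw a b \<in> Laur"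
  by (simp add: sw_def hh_Laur C_zero[OF scalar_ring_Laur])

lemma one_Laur: "1 \<in> Laur"
  by (rule C_one[OF scalar_ring_Laur])

lemma rr_Laur: "rr a b \<in> Laur" "inverse (rr a b) \<in> Laur"
  by (simp_all add: rr_def one_Laur vv_Laur inverse_vv_Laur)

lemma rr_nonzero: "rr a b \<noteq> 0"
  by (simp add: rr_def)

text \<open>In a common row or column the two entries commute up to a power of v, in antidiagonal
  position they commute, and in diagonal position the single correction term has lower
  degree.\<close>

lemma swap_same:
  assumes "{a, b, c, d} \<subseteq> {1..n}"
  shows "\<exists>s\<in>Laur. fT e a c * fT e b d - scal s * (fT e b d * fT e a c)
    \<in> low (deg n (lt e a c) + deg n (lt e b d))"
proof -
  let ?X = "fT e"
  have R: "rttR ?X ?X a b c d \<in> FL"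
    using assms by (intro FL_rttR) (cases e; auto)
  consider "a = b" "c = d" | "a = b" "c < d" | "a = b" "d < c" | "a \<noteq> b" "c = d"
    | "a \<noteq> b" "c \<noteq> d" "a < b \<longleftrightarrow> d < c" | "a < b \<and> c < d \<or> b < a \<and> d < c"
    by linarith
  then show ?thesis
  proof cases
    case 1
    then show ?thesis
      by (intro bexI[of _ 1]) (simp_all add: low.ideal FL_closed one_Laur)
  next
    case 2
    then have "?X a c * ?X b d - scal (inverse vv) * (?X b d * ?X a c)
        = scal (inverse vv) * rttR ?X ?X a b c d"
      by (simp add: rttR_def rr_def sw_def hh_def scal_diff algebra_simps scal_scal)
    then show ?thesis
      using R by (intro bexI[of _ "inverse vv"]) (simp_all add: low.ideal FL_closed inverse_vv_Laur)
  next
    case 3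
    then have "?X a c * ?X b d - scal vv * (?X b d * ?X a c) = scal vv * rttR ?X ?X a b c d"
      by (simp add: rttR_def rr_def sw_def hh_def algebra_simps scal_scal)
    then show ?thesis
      using R by (intro bexI[of _ "vv"]) (simp_all add: low.ideal FL_closed vv_Laur)
  next
    case 4
    \<comment> \<open>The scalar is \<open>inverse vv\<close> or \<open>vv\<close>, according to the
      order of \<open>a\<close> and \<open>b\<close>.\<close>
    then have "?X a c * ?X b d - scal (inverse vv - sw b a) * (?X b d * ?X a c) = rttR ?X ?X a b c d"
      by (simp add: rttR_def rr_def sw_def scal_diff algebra_simps)
    then show ?thesis
      using R by (intro bexI[of _ "inverse vv - sw b a"])
        (simp_all add: low.ideal C_diff[OF scalar_ring_Laur] inverse_vv_Laur sw_Laur)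
  next
    case 5
    then have "?X a c * ?X b d - scal 1 * (?X b d * ?X a c) = rttR ?X ?X a b c d"
      by (auto simp: rttR_def rr_def sw_def)
    then show ?thesis
      using R by (intro bexI[of _ 1]) (simp_all add: low.ideal one_Laur)
  next
    case 6
    then have "?X a c * ?X b d - scal 1 * (?X b d * ?X a c) = rttR ?X ?X a b c d
        + scal (sw c d - sw b a) * (?X b c * ?X a d)"
      by (auto simp: rttR_def rr_def scal_diff algebra_simps)
    moreover have "scal (sw c d - sw b a) * (?X b c * ?X a d)
        \<in> low (deg n (lt e a c) + deg n (lt e b d))"
      using assms 6 deg_diagonal[of e b c a d n]
      by (intro low_prod) (auto simp: C_diff[OF scalar_ring_Laur] sw_Laur)
    ultimately show ?thesis
      using R by (intro bexI[of _ 1]) (simp_all only: low.ideal one_Laur low.add)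
  qed
qed

text \<open>Each correction with valid factors shortens both index intervals, so here monotonicity
  of \<open>dg\<close> is enough.\<close>

lemma mixed_low:
  assumes "{a, b, c, d} \<subseteq> {1..n}"
  shows "scal (rr a b) * (fT False a c * fT True b d) - scal (rr c d) * (fT True b d * fT False a c)
    \<in> low (deg n (lt False a c) + deg n (lt True b d))"
proof -
  have "scal (sw b a) * (fT False b c * fT True a d) \<in> low (deg n (lt False a c) + deg n (lt True b d))"
  proof (cases "b < a")
    case True
    show ?thesis
      using assms True
      by (intro low_prod) (auto simp: sw_Laur valid_def intro!: add_strict_mono dg_mono)
  qed (simp add: sw_def low.ideal FL_closed)
  moreover have "scal (sw c d) * (fT True b c * fT False a d)
      \<in> low (deg n (lt False a c) + deg n (lt True b d))"
  proof (cases "c < d")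
    case True
    then have "deg n (lt True b c) + deg n (lt False a d) < deg n (lt False a c) + deg n (lt True b d)"
      if "b \<le> c" "d \<le> a"
    proof -
      have "dg n (c - b) < dg n (d - b)" "dg n (a - d) < dg n (a - c)"
        using that True assms by (auto intro!: dg_mono)
      then show ?thesis
        by simp
    qed
    with assms show ?thesis
      by (intro low_prod) (auto simp: sw_Laur valid_def)
  qed (simp add: sw_def low.ideal FL_closed)
  moreover have "rttR (fT False) (fT True) a b c d \<in> low (deg n (lt False a c) + deg n (lt True b d))"
    using assms by (intro low.ideal FL_rttR) auto
  ultimately have "rttR (fT False) (fT True) a b c d - scal (sw b a) * (fT False b c * fT True a d)
      + scal (sw c d) * (fT True b c * fT False a d) \<in> low (deg n (lt False a c) + deg n (lt True b d))"
    by (intro low.add low_diff)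
  then show ?thesis
    by (simp add: rttR_def)
qed

lemma swap:
  assumes "g \<in> fgens n" "h \<in> fgens n"
  shows "\<exists>s\<in>Laur. gen g * gen h - scal s * (gen h * gen g) \<in> low (deg n g + deg n h)"
proof -
  from assms(1) obtain e a c where g: "g = lt e a c" "a \<in> {1..n}" "c \<in> {1..n}"
    by (rule fgens_cases)
  from assms(2) obtain e' b d where h: "h = lt e' b d" "b \<in> {1..n}" "d \<in> {1..n}"
    by (rule fgens_cases)
  have Laur: "x \<in> Laur \<Longrightarrow> y \<in> Laur \<Longrightarrow> x * y \<in> Laur" for x y
    by (rule C_mult[OF scalar_ring_Laur])
  consider "e = e'" | "\<not> e" "e'" | "e" "\<not> e'"
    by auto
  then show ?thesis
  proof cases
    case 1
    then show ?thesis
      using swap_same[of a b c d e] g h by (simp add: fT_def)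
  next
    case 2
    let ?M = "scal (rr a b) * (gen g * gen h) - scal (rr c d) * (gen h * gen g)"
    have "?M \<in> low (deg n g + deg n h)"
      using mixed_low[of a b c d] g h 2 by (simp add: fT_def)
    then have "scal (inverse (rr a b)) * ?M \<in> low (deg n g + deg n h)"
      by (intro low_scal rr_Laur)
    moreover have "scal (inverse (rr a b)) * ?M
        = gen g * gen h - scal (inverse (rr a b) * rr c d) * (gen h * gen g)"
      by (simp add: right_diff_distrib scal_scal rr_nonzero)
    ultimately show ?thesis
      using rr_Laur by (intro bexI[of _ "inverse (rr a b) * rr c d"]) (simp_all only: Laur)
  next
    case 3
    \<comment> \<open>The relation with \<open>T^-\<close> first is solved for the opposite product,
      dividing by the unit \<open>rr d c\<close>.\<close>
    let ?M = "scal (rr b a) * (gen h * gen g) - scal (rr d c) * (gen g * gen h)"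
    have "?M \<in> low (deg n g + deg n h)"
      using mixed_low[of b a d c] g h 3 by (simp add: fT_def add.commute)
    then have "scal (- inverse (rr d c)) * ?M \<in> low (deg n g + deg n h)"
      by (intro low_scal rr_Laur C_uminus[OF scalar_ring_Laur])
    moreover have "scal (- inverse (rr d c)) * ?M
        = gen g * gen h - scal (inverse (rr d c) * rr b a) * (gen h * gen g)"
      by (simp add: right_diff_distrib scal_uminus scal_scal rr_nonzero)
    ultimately show ?thesis
      using rr_Laur by (intro bexI[of _ "inverse (rr d c) * rr b a"]) (simp_all only: Laur)
  qed
qed

section \<open>Reduction to normal words, the PBW words of the integral form\<close>

definition normal :: "fgen list \<Rightarrow> bool" where
  "normal xs \<longleftrightarrow> set xs \<subseteq> {lt e i j | e i j. valid e i j \<and> i \<in> {1..n} \<and> j \<in> {1..n}}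
     \<and> sorted (map (key n) xs) \<and> (\<forall>i. \<not> (TP i i \<in> set xs \<and> TM i i \<in> set xs))"

definition NS :: "fgen free set" where
  "NS = {x. \<exists>y. y \<in> free_over Laur UNIV \<and> (\<forall>w\<in>keys y. normal (letters w)) \<and> x - y \<in> FL}"

lemma FL_NS: "x \<in> FL \<Longrightarrow> x \<in> NS"
  unfolding NS_def
  by (intro CollectI exI[of _ 0]) (simp add: free_over_zero scalar_ring_Laur)

lemma NS_add:
  assumes "x \<in> NS" "x' \<in> NS"
  shows "x + x' \<in> NS"
proof -
  from assms obtain y y' where
    "y \<in> free_over Laur UNIV" "\<forall>w\<in>keys y. normal (letters w)" "x - y \<in> FL"
    "y' \<in> free_over Laur UNIV" "\<forall>w\<in>keys y'. normal (letters w)" "x' - y' \<in> FL"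
    unfolding NS_def by auto
  moreover from this have "(x - y) + (x' - y') \<in> FL"
    by (intro FL_closed(2))
  moreover have "keys (y + y') \<subseteq> keys y \<union> keys y'"
    by (rule Poly_Mapping.keys_add)
  ultimately show ?thesis
    unfolding NS_def
    by (intro CollectI exI[of _ "y + y'"]) (auto simp: free_over_add scalar_ring_Laur algebra_simps)
qed

lemma NS_scal:
  assumes "x \<in> NS" "c \<in> Laur"
  shows "scal c * x \<in> NS"
proof -
  from assms obtain y where
    y: "y \<in> free_over Laur UNIV" "\<forall>w\<in>keys y. normal (letters w)" "x - y \<in> FL"
    unfolding NS_def by auto
  then have "scal c * (x - y) \<in> FL"
    using assms by (intro FL_closed(5))
  moreover have "keys (scal c * y) \<subseteq> keys y"
    by (auto simp: in_keys_iff)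
  ultimately show ?thesis
    using y assms unfolding NS_def
    by (intro CollectI exI[of _ "scal c * y"]) (auto simp: free_over_scal scalar_ring_Laur algebra_simps)
qed

lemma NS_low:
  assumes "x \<in> low D" "set u \<subseteq> fgens n" "set w \<subseteq> fgens n"
    and "\<And>g h. g \<in> fgens n \<Longrightarrow> h \<in> fgens n \<Longrightarrow> deg n g + deg n h < D \<Longrightarrow> mon (Word (u @ g # h # w)) \<in> NS"
  shows "mon (Word u) * x * mon (Word w) \<in> NS"
  using assms(1)
proof induction
  case (ideal x)
  then show ?case
    using assms by (intro FL_NS FL_mon)
next
  case (add x y)
  then show ?case
    by (simp add: distrib_left distrib_right NS_add)
next
  case (prod g h c)
  have "mon (Word u) * (scal c * (gen g * gen h)) * mon (Word w) = scal c * mon (Word (u @ g # h # w))"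
    by (simp add: mon_append mon_Cons mult.assoc scal_left_commute)
  with prod assms(4) show ?case
    by (simp add: NS_scal)
qed

lemma not_sorted_descent:
  assumes "\<not> sorted (map f xs)"
  obtains u x y w where "xs = u @ x # y # w" "f y < f x"
proof -
  from assms obtain i where i: "Suc i < length xs" "f (xs ! Suc i) < f (xs ! i)"
    by (auto simp: sorted_iff_nth_Suc not_le)
  then have "xs = take i xs @ xs ! i # xs ! Suc i # drop (Suc (Suc i)) xs"
    by (simp add: Cons_nth_drop_Suc)
  with i that show ?thesis
    by metis
qed

text \<open>The keys of \<open>TP i i\<close> and \<open>TM i i\<close> are consecutive, so in a
  sorted word nothing fits between the last \<open>TP i i\<close> and the first
  \<open>TM i i\<close>.\<close>

lemma sorted_inverse_pair:
  assumes "sorted (map (key n) xs)" "set xs \<subseteq> fgens n" "TP i i \<in> set xs" "TM i i \<in> set xs"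
  obtains u w where "xs = u @ TP i i # TM i i # w"
proof -
  from split_list_last[OF assms(3)] obtain u w where
    xs: "xs = u @ TP i i # w" and w: "TP i i \<notin> set w"
    by auto
  have "TM i i \<notin> set u"
    using assms(1) unfolding xs by (fastforce simp: sorted_append)
  with assms(4) xs have "TM i i \<in> set w"
    by auto
  then obtain h w' where h: "w = h # w'"
    by (cases w) auto
  have "key n (TP i i) \<le> key n h" "key n h \<le> key n (TM i i)"
    using assms(1) \<open>TM i i \<in> set w\<close> unfolding xs h by (auto simp: sorted_append)
  moreover have "key n h \<noteq> key n (TP i i)"
    using w assms(2) inj_onD[OF key_inj, of n h "TP i i"] unfolding xs h by auto
  ultimately have "key n h = key n (TM i i)"
    by simp
  then have "h = TM i i"
    using assms(2,4) inj_onD[OF key_inj, of n h "TM i i"] unfolding xs h by auto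
  with that show ?thesis
    unfolding xs h by blast
qed

lemma mon_NS:
  assumes "set xs \<subseteq> fgens n"
  shows "mon (Word xs) \<in> NS"
proof -
  \<comment> \<open>An exchange keeps the degree and lowers the keys lexicographically, its
    corrections lower the degree, and cancelling an inverse pair keeps the degree and shortens the
    word.\<close>
  define r where "r = inv_image (less_than <*lex*> lenlex less_than)
    (\<lambda>xs. (sum_list (map (deg n) xs), map (key n) xs))"
  have "wf r"
    unfolding r_def by (intro wf_inv_image wf_lex_prod wf_lenlex wf_less_than)
  then show ?thesis
    using assms
  proof (induction xs rule: wf_induct_rule)
    case (less xs)
    consider (invalid) g where "g \<in> set xs" "gen g \<in> FL"
      | (descent) "\<not> sorted (map (key n) xs)"
      | (inverse) i where "sorted (map (key n) xs)" "TP i i \<in> set xs" "TM i i \<in> set xs"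
      | (normal) "normal xs"
    proof (cases "\<exists>g\<in>set xs. gen g \<in> FL")
      case False
      have "set xs \<subseteq> {lt e i j | e i j. valid e i j \<and> i \<in> {1..n} \<and> j \<in> {1..n}}"
      proof
        fix g assume "g \<in> set xs"
        with less.prems have "g \<in> fgens n"
          by auto
        then obtain e i j where g: "g = lt e i j" "i \<in> {1..n}" "j \<in> {1..n}"
          by (rule fgens_cases)
        moreover have "valid e i j"
          using False \<open>g \<in> set xs\<close> FL_invalid[OF _ g(2,3)] g(1) by blast
        ultimately show "g \<in> {lt e i j | e i j. valid e i j \<and> i \<in> {1..n} \<and> j \<in> {1..n}}"
          by blast
      qed
      then show ?thesis
        using that unfolding normal_def by blast
    qed (use that in blast)
    then show ?case
    proof cases
      case invalid
      then obtain u w where xs: "xs = u @ g # w"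
        using split_list by fastforce
      have "mon (Word u) * gen g * mon (Word w) \<in> FL"
        using invalid less.prems unfolding xs by (intro FL_mon) auto
      then show ?thesis
        by (simp add: FL_NS xs mon_append mon_Cons mult.assoc)
    next
      case descent
      then obtain u g h w where xs: "xs = u @ g # h # w" and key: "key n h < key n g"
        by (rule not_sorted_descent)
      have gh: "g \<in> fgens n" "h \<in> fgens n" "set u \<subseteq> fgens n" "set w \<subseteq> fgens n"
        using less.prems xs by auto
      from swap[OF gh(1,2)] obtain s where s: "s \<in> Laur"
        "gen g * gen h - scal s * (gen h * gen g) \<in> low (deg n g + deg n h)"
        by auto
      have "mon (Word u) * (gen g * gen h - scal s * (gen h * gen g)) * mon (Word w) \<in> NS"
      proof (rule NS_low[OF s(2) gh(3,4)])
        fix g' h' assume "g' \<in> fgens n" "h' \<in> fgens n" "deg n g' + deg n h' < deg n g + deg n h"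
        then show "mon (Word (u @ g' # h' # w)) \<in> NS"
          using gh by (intro less.IH) (auto simp: r_def xs)
      qed
      moreover have "mon (Word (u @ h # g # w)) \<in> NS"
        using gh key by (intro less.IH) (auto simp: r_def xs lenlex_conv intro!: lex_append_leftI)
      then have "scal s * mon (Word (u @ h # g # w)) \<in> NS"
        using s(1) by (rule NS_scal)
      ultimately have "mon (Word u) * (gen g * gen h - scal s * (gen h * gen g)) * mon (Word w)
          + scal s * mon (Word (u @ h # g # w)) \<in> NS"
        by (rule NS_add)
      moreover have "mon (Word u) * (gen g * gen h - scal s * (gen h * gen g)) * mon (Word w)
          + scal s * mon (Word (u @ h # g # w)) = mon (Word xs)"
        by (simp add: xs mon_append mon_Cons left_diff_distrib right_diff_distrib mult.assoc
            scal_left_commute[of "mon w" for w])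
      ultimately show ?thesis
        by simp
    next
      case inverse
      from sorted_inverse_pair[OF inverse(1) less.prems inverse(2,3)]
      obtain u w where xs: "xs = u @ TP i i # TM i i # w" .
      have uw: "set u \<subseteq> fgens n" "set w \<subseteq> fgens n" "i \<in> {1..n}"
        using less.prems xs by (auto simp: fgens_def)
      have "mon (Word u) * (gen (TP i i) * gen (TM i i) - 1) * mon (Word w) \<in> FL"
        using uw by (intro FL_mon FL_base frels_intros)
      moreover have "mon (Word (u @ w)) \<in> NS"
        using uw by (intro less.IH) (auto simp: r_def xs lenlex_conv)
      ultimately have "mon (Word u) * (gen (TP i i) * gen (TM i i) - 1) * mon (Word w)
          + mon (Word (u @ w)) \<in> NS"
        by (intro NS_add[OF FL_NS])
      then show ?thesis
        by (simp add: xs mon_append mon_Cons algebra_simps)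
    next
      case normal
      then show ?thesis
        unfolding NS_def
        by (intro CollectI exI[of _ "mon (Word xs)"])
           (simp add: free_over_mon scalar_ring_Laur FL_closed, simp add: mon_def)
    qed
  qed
qed

lemma free_over_NS:
  assumes "f \<in> free_over Laur (fgens n)"
  shows "f \<in> NS"
  using assms
proof (induction f rule: free_over_induct[OF scalar_ring_Laur, consumes 1])
  case 1
  then show ?case
    by (simp add: FL_NS FL_closed)
next
  case (2 c w f)
  then show ?case
    using mon_NS[of "letters w"] by (simp add: NS_add NS_scal)
qed

end

section \<open>The tensor powers of the vector representation\<close>

text \<open>\<open>site e i j\<close> is the action of \<open>t\<^sup>\<plusminus>\<^sub>i\<^sub>j\<close> on functions on words, i.e. on all tensor powers at once: on a
  single letter, \<open>T\<^sup>-\<close> acts by \<open>R\<close> and \<open>T\<^sup>+\<close> by \<open>R\<^sub>2\<^sub>1\<^sup>-\<^sup>1\<close>, and words are handled by the coproduct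
  \<open>T \<mapsto> T \<otimes> T\<close>.\<close>

definition dd :: "bool \<Rightarrow> nat \<Rightarrow> nat \<Rightarrow> K" where
  "dd e i x = (if i = x then if e then vv else inverse vv else 1)"

definition cc :: "bool \<Rightarrow> nat \<Rightarrow> nat \<Rightarrow> K" where
  "cc e i x = (if e then - sw i x else sw x i)"

fun site :: "bool \<Rightarrow> nat \<Rightarrow> nat \<Rightarrow> (nat list \<Rightarrow> K) \<Rightarrow> nat list \<Rightarrow> K" where
  "site e i j F [] = (if i = j then F [] else 0)"
| "site e i j F (x # w) =
     dd e i x * site e i j (\<lambda>u. F (x # u)) w + cc e i x * site e x j (\<lambda>u. F (i # u)) w"

lemma site_linear:
  "site e i j (\<lambda>u. a * F u + b * G u) w = a * site e i j F w + b * site e i j G w"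
  by (induction w arbitrary: F G i) (simp_all add: algebra_simps)

lemma site_site_Cons:
  "site e a c (site e' b d F) (x # w) =
     dd e a x * (dd e' b x * site e a c (site e' b d (\<lambda>u. F (x # u))) w
               + cc e' b x * site e a c (site e' x d (\<lambda>u. F (b # u))) w)
   + cc e a x * (dd e' b a * site e x c (site e' b d (\<lambda>u. F (a # u))) w
               + cc e' b a * site e x c (site e' a d (\<lambda>u. F (b # u))) w)"
  by (simp add: site_linear)

text \<open>The Yang-Baxter equation on the indices \<open>a\<close>, \<open>b\<close>,
  \<open>x\<close>, in the form of the inductive step: \<open>Z\<close> stands for values on the
  rest of a word and \<open>S\<close> for the side of the RTT relation that the induction hypothesis
  rewrites.\<close>

lemma site_yang_baxter:
  fixes Z :: "nat \<Rightarrow> nat \<Rightarrow> nat \<Rightarrow> K"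
  assumes "(e, e') \<in> {(True, True), (False, False), (False, True)}"
  defines "S \<equiv> \<lambda>p q y. rr p q * Z p q y + sw q p * Z q p y"
  shows "rr a b * (dd e a x * (dd e' b x * Z a b x + cc e' b x * Z a x b)
           + cc e a x * (dd e' b a * Z x b a + cc e' b a * Z x a b))
       + sw b a * (dd e b x * (dd e' a x * Z b a x + cc e' a x * Z b x a)
           + cc e b x * (dd e' a b * Z x a b + cc e' a b * Z x b a))
       = dd e' b x * (dd e a x * S a b x + cc e a x * S x b a)
           + cc e' b x * (dd e a b * S a x b + cc e a b * S b x a)"
proof -
  have v: "vv * (inverse vv * x) = x" "inverse vv * (vv * x) = x" for x
    by (simp_all add: mult.assoc[symmetric])
  show ?thesis
    unfolding S_def
    by (rule linorder_cases[of a b]; rule linorder_cases[of a x]; rule linorder_cases[of b x])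
      (use assms(1) in \<open>auto simp: rr_def sw_def dd_def cc_def hh_def algebra_simps v\<close>)
qed

text \<open>The relations are moved past the first letter by the Yang-Baxter equation and past the
  rest by induction.\<close>

lemma site_rtt:
  assumes "(e, e') \<in> {(True, True), (False, False), (False, True)}"
  shows "rr a b * site e a c (site e' b d F) w + sw b a * site e b c (site e' a d F) w
       = rr c d * site e' b d (site e a c F) w + sw c d * site e' b c (site e a d F) w"
proof (induction w arbitrary: F a b)
  case Nil
  then show ?case
    by (auto simp: rr_def sw_def)
next
  case (Cons x w)
  let ?Z = "\<lambda>p q y. site e p c (site e' q d (\<lambda>u. F (y # u))) w"
  let ?S = "\<lambda>p q y. rr c d * site e' q d (site e p c (\<lambda>u. F (y # u))) w
                + sw c d * site e' q c (site e p d (\<lambda>u. F (y # u))) w"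
  have IH: "rr p q * ?Z p q y + sw q p * ?Z q p y = ?S p q y" for p q y
    by (rule Cons.IH)
  have "rr a b * site e a c (site e' b d F) (x # w) + sw b a * site e b c (site e' a d F) (x # w)
      = dd e' b x * (dd e a x * ?S a b x + cc e a x * ?S x b a)
           + cc e' b x * (dd e a b * ?S a x b + cc e a b * ?S b x a)"
    unfolding site_site_Cons IH[symmetric] by (rule site_yang_baxter[OF assms])
  also have "\<dots> = rr c d * site e' b d (site e a c F) (x # w)
      + sw c d * site e' b c (site e a d F) (x # w)"
    unfolding site_site_Cons by (simp only: ring_distribs mult_ac add_ac)
  finally show ?case .
qed

lemma site_invalid: "(if e then j < i else i < j) \<Longrightarrow> site e i j F w = 0"
  by (induction w arbitrary: F i) (auto simp: cc_def sw_def)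

text \<open>In the coproduct of a diagonal generator, triangularity kills every term whose
  intermediate index differs from \<open>i\<close>.\<close>

lemma site_diag:
  "site e i i F w = (if e then vv else inverse vv) ^ count_list w i * F w"
proof (induction w arbitrary: F)
  case (Cons x w)
  have "cc e i x * site e x i (\<lambda>u. F (i # u)) w = 0"
    using site_invalid[of e i x] by (auto simp: cc_def sw_def)
  then show ?case
    using Cons[of "\<lambda>u. F (x # u)"] by (cases "i = x") (simp_all add: dd_def cc_def sw_def)
qed simp

section \<open>The action of the free algebra and of its RTT quotient\<close>

fun actg :: "fgen \<Rightarrow> (nat list \<Rightarrow> K) \<Rightarrow> nat list \<Rightarrow> K" where
  "actg (TP i j) = site True i j"
| "actg (TM i j) = site False i j"

definition actw :: "fgen list \<Rightarrow> (nat list \<Rightarrow> K) \<Rightarrow> nat list \<Rightarrow> K" where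
  "actw gs = foldr actg gs"

definition act :: "fgen free \<Rightarrow> (nat list \<Rightarrow> K) \<Rightarrow> nat list \<Rightarrow> K" where
  "act f F w = (\<Sum>u\<in>keys f. lookup f u * actw (letters u) F w)"

lemma actw_simps [simp]:
  "actw [] F = F" "actw (g # gs) F = actg g (actw gs F)" "actw (gs @ hs) F = actw gs (actw hs F)"
  by (simp_all add: actw_def)

lemma actg_linear: "actg g (\<lambda>u. a * F u + b * G u) w = a * actg g F w + b * actg g G w"
  by (cases g) (simp_all add: site_linear)

lemma actw_linear: "actw gs (\<lambda>u. a * F u + b * G u) w = a * actw gs F w + b * actw gs G w"
proof (induction gs arbitrary: w)
  case (Cons g gs)
  then have "actw gs (\<lambda>u. a * F u + b * G u) = (\<lambda>w. a * actw gs F w + b * actw gs G w)"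
    by blast
  then show ?case
    by (simp add: actg_linear)
qed simp

lemma act_zero: "act 0 F w = 0"
  by (simp add: act_def)

lemma act_add: "act (f + g) F w = act f F w + act g F w"
  unfolding act_def by (rule sum_keys_add) (simp_all add: distrib_right)

lemma act_term: "act (scal c * mon u) F w = c * actw (letters u) F w"
  unfolding act_def by (rule sum_keys_term) simp

lemma act_uminus: "act (- f) F w = - act f F w"
  using act_add[of f "- f" F w] by (simp add: act_zero eq_neg_iff_add_eq_0 add.commute)

lemma act_diff: "act (f - g) F w = act f F w - act g F w"
  using act_add[of f "- g" F w] by (simp add: act_uminus)

lemma act_sandwich:
  "act (scal c * mon u * s * mon t) F w = c * actw (letters u) (act s (actw (letters t) F)) w"
proof (induction s arbitrary: w rule: free_induct)
  case zero
  have "actw gs (\<lambda>u. 0) w = 0" for gs w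
    using actw_linear[of gs 0 "\<lambda>u. 0" 0 "\<lambda>u. 0" w] by simp
  then show ?case
    by (simp add: act_zero)
next
  case (step d r s)
  have "scal c * mon u * (scal d * mon r) * mon t = scal (c * d) * mon (u + r + t)"
    unfolding term_mult by (simp add: mult.assoc mon_plus)
  then have "act (scal c * mon u * (scal d * mon r + s) * mon t) F w
      = c * (d * actw (letters u) (actw (letters r) (actw (letters t) F)) w
            + 1 * actw (letters u) (act s (actw (letters t) F)) w)"
    by (simp add: distrib_left distrib_right act_add act_term step plus_word_def)
  also have "\<dots> = c * actw (letters u) (act (scal d * mon r + s) (actw (letters t) F)) w"
  proof -
    have "act (scal d * mon r + s) (actw (letters t) F)
        = (\<lambda>w. d * actw (letters r) (actw (letters t) F) w + 1 * act s (actw (letters t) F) w)"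
      by (rule ext) (simp add: act_add act_term)
    then show ?thesis
      by (simp only: actw_linear)
  qed
  finally show ?case .
qed

lemma act_gen_gen: "act (scal c * (gen g * gen h)) F w = c * actg g (actg h F) w"
proof -
  have "gen g * gen h = mon (Word [g, h])"
    by (simp add: mon_Cons)
  then show ?thesis
    by (simp add: act_term)
qed

lemma act_one: "act 1 F w = F w"
  using act_term[of 1 0 F w] by (simp add: zero_word_def)

lemma act_frels:
  assumes "s \<in> frels n"
  shows "act s F w = 0"
proof -
  have inv: "site True i i (site False i i F) w = F w" "site False i i (site True i i F) w = F w" for i
    by (simp_all add: site_diag mult.assoc[symmetric] flip: power_mult_distrib)
  have gg: "act (gen g * gen h) F w = actg g (actg h F) w" for g h
    using act_gen_gen[of 1 g h F w] by simp
  have g1: "act (gen g) F w = actg g F w" for g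
    using act_term[of 1 "Word [g]" F w] by (simp add: gen_eq_mon)
  have actT: "actg (if e then TP i j else TM i j) F = site e i j F" for e i j F
    by simp
  from assms show ?thesis
    unfolding frels_def
  proof (elim UnE CollectE exE conjE, goal_cases)
    case (5 e e' a b c d)
    have "act s F w = rr a b * site e a c (site e' b d F) w + sw b a * site e b c (site e' a d F) w
      - rr c d * site e' b d (site e a c F) w - sw c d * site e' b c (site e a d F) w"
      unfolding 5(1) frtt_eq[OF 5(3)] rttR_def fT_def act_add act_diff act_gen_gen actT ..
    then show ?case
      using site_rtt[OF 5(2), of a b c d F w] by simp
  qed (simp_all add: act_diff act_one gg g1 inv site_invalid)
qed

text \<open>So tensor powers are modules for the finite RTT algebra over the field, and a relation
  among normal words can be tested on them.\<close>

lemma act_ideal: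
  assumes "x \<in> ideal_gen UNIV (fgens n) (frels n)"
  shows "act x F w = 0"
  using assms
proof (induction arbitrary: w)
  case (gen s c u t)
  have "actw gs (\<lambda>u. 0) w = 0" for gs w
    using actw_linear[of gs 0 "\<lambda>u. 0" 0 "\<lambda>u. 0" w] by simp
  moreover have "act s (actw (letters t) F) = (\<lambda>u. 0)"
    using act_frels[OF gen(1)] by auto
  ultimately show ?case
    by (simp add: act_sandwich)
qed (simp_all add: act_zero act_add)

section \<open>Specialisation at \<open>v = 1\<close>\<close>

text \<open>\<open>Reg x c\<close>: the rational function \<open>x\<close> is regular at \<open>v = 1\<close> with value \<open>c\<close>.\<close>

definition Reg :: "K \<Rightarrow> complex \<Rightarrow> bool" where
  "Reg x c \<longleftrightarrow> (\<exists>p q. x = Fract p q \<and> poly q 1 \<noteq> 0 \<and> c = poly p 1 / poly q 1)"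

lemma Reg_Fract: "poly q 1 \<noteq> 0 \<Longrightarrow> Reg (Fract p q) (poly p 1 / poly q 1)"
  unfolding Reg_def by blast

lemma Reg_add: "Reg x a \<Longrightarrow> Reg y b \<Longrightarrow> Reg (x + y) (a + b)"
  unfolding Reg_def
proof (elim exE conjE)
  fix p q p' q'
  assume *: "x = Fract p q" "poly q 1 \<noteq> 0" "a = poly p 1 / poly q 1"
    "y = Fract p' q'" "poly q' 1 \<noteq> 0" "b = poly p' 1 / poly q' 1"
  then have "q \<noteq> 0" "q' \<noteq> 0"
    by auto
  then have "x + y = Fract (p * q' + p' * q) (q * q')"
    "a + b = poly (p * q' + p' * q) 1 / poly (q * q') 1" "poly (q * q') 1 \<noteq> 0"
    using *(2,5) by (simp_all add: *(1,3,4,6) add_frac_eq)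
  then show "\<exists>p q. x + y = Fract p q \<and> poly q 1 \<noteq> 0 \<and> a + b = poly p 1 / poly q 1"
    by blast
qed

lemma Reg_mult: "Reg x a \<Longrightarrow> Reg y b \<Longrightarrow> Reg (x * y) (a * b)"
  unfolding Reg_def
proof (elim exE conjE)
  fix p q p' q'
  assume *: "x = Fract p q" "poly q 1 \<noteq> 0" "a = poly p 1 / poly q 1"
    "y = Fract p' q'" "poly q' 1 \<noteq> 0" "b = poly p' 1 / poly q' 1"
  then have "x * y = Fract (p * p') (q * q')" "a * b = poly (p * p') 1 / poly (q * q') 1"
    "poly (q * q') 1 \<noteq> 0"
    by simp_all
  then show "\<exists>p q. x * y = Fract p q \<and> poly q 1 \<noteq> 0 \<and> a * b = poly p 1 / poly q 1"
    by blast
qed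

lemma Reg_0: "Reg 0 0"
  using Reg_Fract[of 1 0] by (simp add: Zero_fract_def)

lemma Reg_1: "Reg 1 1"
  using Reg_Fract[of 1 1] by (simp add: One_fract_def)

lemma Reg_vv: "Reg vv 1"
  using Reg_Fract[of 1 "[:0, 1:]"] by (simp add: vv_def)

lemma Reg_inverse_vv: "Reg (inverse vv) 1"
  using Reg_Fract[of "[:0, 1:]" 1] by (simp add: vv_def)

lemma Reg_uminus: "Reg x a \<Longrightarrow> Reg (- x) (- a)"
  unfolding Reg_def by (metis minus_divide_left minus_fract poly_minus)

lemma Reg_hh: "Reg hh 0"
  using Reg_add[OF Reg_inverse_vv Reg_uminus[OF Reg_vv]] by (simp add: hh_def)

lemma Reg_power: "Reg x a \<Longrightarrow> Reg (x ^ k) (a ^ k)"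
  by (induction k) (simp_all add: Reg_1 Reg_mult)

lemma Reg_sum: "(\<And>x. x \<in> A \<Longrightarrow> Reg (f x) (g x)) \<Longrightarrow> Reg (sum f A) (sum g A)"
  by (induction A rule: infinite_finite_induct) (auto simp: Reg_0 Reg_add)

lemma Reg_0_unique: "Reg 0 c \<Longrightarrow> c = 0"
  unfolding Reg_def
proof (elim exE conjE)
  fix p q
  assume "0 = Fract p q" "poly q 1 \<noteq> 0" "c = poly p 1 / poly q 1"
  moreover from this have "q \<noteq> 0"
    by auto
  ultimately show "c = 0"
    by (simp add: Zero_fract_def eq_fract)
qed

lemma common_denominator:
  fixes Q :: "'a \<Rightarrow> K"
  assumes "finite A"
  shows "\<exists>d p. d \<noteq> 0 \<and> (\<forall>x\<in>A. d * Q x = Fract (p x) 1)"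
  using assms
proof induction
  case (insert x A)
  then obtain d p where d: "d \<noteq> 0" "\<forall>x\<in>A. d * Q x = Fract (p x) 1"
    by auto
  obtain a b where ab: "Q x = Fract a b" "b \<noteq> 0"
    by (cases "Q x")
  obtain e f where ef: "d = Fract e f" "f \<noteq> 0"
    by (cases d)
  define d' where "d' = Fract (f * b) 1 * d"
  have "d' * Q x = Fract (a * e) 1"
    using ab ef by (simp add: d'_def eq_fract)
  moreover have "d' * Q y = Fract (f * b * p y) 1" if "y \<in> A" for y
    using d(2) that by (simp add: d'_def mult.assoc)
  moreover have "d' \<noteq> 0"
    using d(1) ab ef by (simp add: d'_def Zero_fract_def eq_fract)
  ultimately show ?case
    using insert(2)
    by (intro exI[of _ d'] exI[of _ "\<lambda>y. if y = x then a * e else f * b * p y"]) auto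
qed (auto intro: exI[of _ 1])

text \<open>Common factors v - 1 are split off until some member no longer vanishes at 1; the degree
  of one nonzero member bounds the number of steps.\<close>

lemma primitive_at_1:
  fixes p :: "'a \<Rightarrow> complex poly"
  assumes "x0 \<in> A" "p x0 \<noteq> 0"
  shows "\<exists>k r. (\<forall>x\<in>A. p x = [:-1, 1:] ^ k * r x) \<and> (\<exists>x\<in>A. poly (r x) 1 \<noteq> 0)"
  using assms(2)
proof (induction "degree (p x0)" arbitrary: p rule: less_induct)
  case less
  show ?case
  proof (cases "\<exists>x\<in>A. poly (p x) 1 \<noteq> 0")
    case True
    then show ?thesis
      by (intro exI[of _ 0] exI[of _ p]) simp
  next
    case False
    then have "\<forall>x\<in>A. [:-1, 1:] dvd p x"
      by (auto simp only: poly_eq_0_iff_dvd)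
    then have "\<forall>x\<in>A. \<exists>q. p x = [:-1, 1:] * q"
      unfolding dvd_def .
    then obtain q where q: "\<forall>x\<in>A. p x = [:-1, 1:] * q x"
      by metis
    have "q x0 \<noteq> 0"
      using q assms(1) less.prems by auto
    moreover from this have "degree (p x0) = degree [:-1, 1 :: complex:] + degree (q x0)"
      unfolding bspec[OF q assms(1)] by (intro degree_mult_eq) simp_all
    ultimately obtain k r where
      r: "\<forall>x\<in>A. q x = [:-1, 1:] ^ k * r x" "\<exists>x\<in>A. poly (r x) 1 \<noteq> 0"
      using less.hyps[of q] by auto
    have "\<forall>x\<in>A. p x = [:-1, 1:] ^ Suc k * r x"
      unfolding power_Suc mult.assoc
    proof
      fix x assume "x \<in> A"
      then show "p x = [:-1, 1:] * ([:-1, 1:] ^ k * r x)"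
        using bspec[OF q] bspec[OF r(1)] by (simp only:)
    qed
    with r(2) show ?thesis
      by blast
  qed
qed

text \<open>Clear denominators, then remove the common power of v - 1. Coefficients of a nontrivial
  relation over the field are thereby rescaled so that the relation stays nontrivial at v =
  1.\<close>

lemma normalise_at_1:
  fixes Q :: "'a \<Rightarrow> K"
  assumes "finite A" "x0 \<in> A" "Q x0 \<noteq> 0"
  obtains s q where "\<And>x. x \<in> A \<Longrightarrow> Reg (s * Q x) (q x)" "\<exists>x\<in>A. q x \<noteq> 0"
proof -
  from common_denominator[OF assms(1), of Q] obtain d p where
    d: "d \<noteq> 0" "\<forall>x\<in>A. d * Q x = Fract (p x) 1"
    by auto
  have "d * Q x0 \<noteq> 0"
    using d assms by auto
  then have "p x0 \<noteq> 0"
    using d assms(2) by (auto simp: Zero_fract_def)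
  from primitive_at_1[of x0 A p, OF assms(2) this] obtain k r where
    r: "\<forall>x\<in>A. p x = [:-1, 1:] ^ k * r x" "\<exists>x\<in>A. poly (r x) 1 \<noteq> 0"
    by auto
  have "Reg (Fract 1 ([:-1, 1:] ^ k) * d * Q x) (poly (r x) 1)" if "x \<in> A" for x
  proof -
    have "Fract 1 ([:-1, 1:] ^ k) * d * Q x = Fract (r x) 1"
      using d r that by (simp add: mult.assoc eq_fract)
    then show ?thesis
      using Reg_Fract[of 1 "r x"] by simp
  qed
  with r(2) show ?thesis
    by (intro that[of "Fract 1 ([:-1, 1:] ^ k) * d" "\<lambda>x. poly (r x) 1"])
qed

subsection \<open>The classical limit of the tensor representation\<close>

text \<open>The classical matrix unit acting on all tensor powers: it sums \<open>f\<close> over the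
  words obtained by turning one letter \<open>j\<close> into \<open>i\<close>. Values in the natural
  numbers exclude cancellation.\<close>

fun cl :: "nat \<Rightarrow> nat \<Rightarrow> (nat list \<Rightarrow> nat) \<Rightarrow> nat list \<Rightarrow> nat" where
  "cl i j f [] = 0"
| "cl i j f (x # w) = cl i j (\<lambda>u. f (x # u)) w + (if x = j then f (i # w) else 0)"

fun clw :: "(nat \<times> nat) list \<Rightarrow> (nat list \<Rightarrow> nat) \<Rightarrow> nat list \<Rightarrow> nat" where
  "clw [] f = f"
| "clw (p # ps) f = cl (fst p) (snd p) (clw ps f)"

lemma site_diag_Reg:
  assumes "Reg (F w) (of_nat (f w))"
  shows "Reg (site e i i F w) (of_nat (f w))"
  using Reg_mult[OF Reg_power[of "if e then vv else inverse vv" 1 "count_list w i"] assms]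
  by (simp add: site_diag Reg_vv Reg_inverse_vv)

definition hs :: "bool \<Rightarrow> K" where "hs e = (if e then - hh else hh)"

lemma hs_nonzero: "hs e \<noteq> 0"
  by (simp add: hs_def hh_nonzero)

text \<open>In the coproduct, a term with intermediate index \<open>i\<close> or \<open>j\<close>
  carries one factor \<open>hs e\<close>; an index strictly between gives two, and that term
  disappears at v = 1.\<close>

lemma site_off_Reg:
  assumes "\<And>u. Reg (F u) (of_nat (f u))" "if e then i < j else j < i"
  shows "Reg (site e i j F w / hs e) (of_nat (cl i j f w))"
  using assms
proof (induction w arbitrary: F f i)
  case Nil
  then show ?case
    by (auto simp: Reg_0)
next
  case (Cons x w)
  have dd: "Reg (dd e i x) 1"
    by (simp add: dd_def Reg_1 Reg_vv Reg_inverse_vv)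
  have 1: "Reg (dd e i x * (site e i j (\<lambda>u. F (x # u)) w / hs e)) (1 * of_nat (cl i j (\<lambda>u. f (x # u)) w))"
    using Cons.prems by (intro Reg_mult dd Cons.IH) auto
  have cc: "cc e i x / hs e = (if (if e then i < x else x < i) then 1 else 0)"
    by (auto simp: cc_def hs_def sw_def hh_nonzero)
  have 2: "Reg (cc e i x / hs e * site e x j (\<lambda>u. F (i # u)) w) (of_nat (if x = j then f (i # w) else 0))"
  proof (cases "x = j")
    case True
    then have "cc e i x / hs e = 1"
      using True Cons.prems(2) unfolding cc by (auto split: if_splits)
    then show ?thesis
      using True Cons.prems site_diag_Reg[of "\<lambda>u. F (i # u)" w "\<lambda>u. f (i # u)" e j]
      by (simp only: if_True mult_1 simp_thms)
  next
    case False
    show ?thesis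
    proof (cases "if e then x < j else j < x")
      case True
      \<comment> \<open>The tail brings a factor \<open>hs e\<close> of its own, which the division
        does not remove and which vanishes at v = 1.\<close>
      have "Reg (hs e * (site e x j (\<lambda>u. F (i # u)) w / hs e)) (0 * of_nat (cl x j (\<lambda>u. f (i # u)) w))"
      proof (rule Reg_mult)
        show "Reg (hs e) 0"
          using Reg_uminus[OF Reg_hh] by (simp add: hs_def Reg_hh)
      qed (use Cons True in auto)
      then show ?thesis
        unfolding cc using False by (simp add: hs_nonzero Reg_0)
    next
      case 2: False
      with False have "site e x j (\<lambda>u. F (i # u)) w = 0"
        by (intro site_invalid) (auto split: if_splits)
      with False show ?thesis
        by (simp add: Reg_0)
    qed
  qed
  show ?case
    using Reg_add[OF 1 2] by (simp add: add_divide_distrib)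
qed

definition off :: "nat \<Rightarrow> fgen set" where
  "off n = {lt e i j | e i j. (if e then i < j else j < i) \<and> i \<in> {1..n} \<and> j \<in> {1..n}}"

fun pr :: "fgen \<Rightarrow> nat \<times> nat" where
  "pr (TP i j) = (i, j)"
| "pr (TM i j) = (i, j)"

fun ghs :: "fgen \<Rightarrow> K" where
  "ghs (TP i j) = hs True"
| "ghs (TM i j) = hs False"

definition whs :: "fgen list \<Rightarrow> K" where
  "whs gs = prod_list (map ghs gs)"

lemma whs_nonzero: "whs gs \<noteq> 0"
proof -
  have "ghs g \<noteq> 0" for g
    by (cases g) (simp_all add: hs_nonzero)
  then show ?thesis
    by (induction gs) (simp_all add: whs_def)
qed

lemma actw_off_Reg:
  assumes "set gs \<subseteq> off n" "\<And>u. Reg (F u) (of_nat (f u))"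
  shows "Reg (actw gs F w / whs gs) (of_nat (clw (map pr gs) f w))"
  using assms(1)
proof (induction gs arbitrary: w)
  case (Cons g gs)
  define G where "G u = actw gs F u / whs gs" for u
  have G: "Reg (G u) (of_nat (clw (map pr gs) f u))" for u
    unfolding G_def using Cons by simp
  from Cons.prems have "g \<in> off n"
    by simp
  then obtain e i j where g: "g = lt e i j" "if e then i < j else j < i"
    by (auto simp: off_def)
  have "Reg (site e i j G w / hs e) (of_nat (cl i j (clw (map pr gs) f) w))"
    using G g by (intro site_off_Reg) auto
  moreover have "actw (g # gs) F w / whs (g # gs) = site e i j G w / hs e"
  proof -
    \<comment> \<open>The zero summand brings the function into the two-term form of
      \<open>actg_linear\<close>.\<close>
    have "actw gs F = (\<lambda>u. whs gs * G u + 0 * G u)"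
      by (auto simp: G_def whs_nonzero)
    then have "actw (g # gs) F w = whs gs * actg g G w"
      by (simp only: actw_simps actg_linear) simp
    then show ?thesis
      using g whs_nonzero[of gs] by (cases e) (simp_all add: whs_def)
  qed
  moreover have "pr g = (i, j)"
    using g by (cases e) auto
  ultimately show ?case
    by simp
qed (simp add: whs_def assms)

section \<open>Letter changes and extremal matrix coefficients of the classical operators\<close>

definition chg :: "nat list \<Rightarrow> nat list \<Rightarrow> (nat \<times> nat) multiset" where
  "chg w w' = mset (filter (\<lambda>(y, x). y \<noteq> x) (zip w' w))"

lemma chg_append:
  "length a = length a' \<Longrightarrow> chg (a @ b) (a' @ b') = chg a a' + chg b b'"
  by (simp add: chg_def)

lemma chg_Cons: "chg (x # w) (y # w') = (if y = x then {#} else {#(y, x)#}) + chg w w'"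
  by (simp add: chg_def)

lemma chg_same: "chg w w = {#}"
  by (induction w) (simp_all add: chg_Cons, simp add: chg_def)

lemma cl_nonzero: "cl i j f w \<noteq> 0 \<Longrightarrow> \<exists>a b. w = a @ j # b \<and> f (a @ i # b) \<noteq> 0"
proof (induction w arbitrary: f)
  case (Cons x w)
  show ?case
  proof (cases "cl i j (\<lambda>u. f (x # u)) w = 0")
    case True
    with Cons.prems show ?thesis
      by (intro exI[of _ "[]"] exI[of _ w]) (auto split: if_splits)
  next
    case False
    from Cons.IH[OF this] obtain a b where "w = a @ j # b" "f (x # a @ i # b) \<noteq> 0"
      by auto
    then show ?thesis
      by (intro exI[of _ "x # a"] exI[of _ b]) simp
  qed
qed simp

lemma cl_ge: "f (a @ i # b) \<le> cl i j f (a @ j # b)"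
proof (induction a arbitrary: f)
  case (Cons x a)
  then show ?case
    using Cons[of "\<lambda>u. f (x # u)"] by simp
qed simp

definition delta :: "nat list \<Rightarrow> nat list \<Rightarrow> nat" where
  "delta w' u = (if u = w' then 1 else 0)"

text \<open>Each operator alters one letter, so at most \<open>length ps\<close> positions can
  differ; if that many do, every operator had a position to itself and the recorded changes are the
  operators.\<close>

lemma clw_nonzero:
  assumes "clw ps (delta w') w \<noteq> 0" "\<forall>p\<in>set ps. fst p \<noteq> snd p"
  shows "length w = length w' \<and> size (chg w w') \<le> length ps
    \<and> (size (chg w w') = length ps \<longrightarrow> chg w w' = mset ps)"
  using assms
proof (induction ps arbitrary: w)
  case Nil
  then show ?case
    by (auto simp: delta_def chg_same split: if_splits)
next
  case (Cons p ps)
  obtain i j where p: "p = (i, j)"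
    by (cases p)
  with Cons.prems obtain a b where w: "w = a @ j # b" and nz: "clw ps (delta w') (a @ i # b) \<noteq> 0"
    using cl_nonzero[of i j "clw ps (delta w')" w] by auto
  note IH = Cons.IH[OF nz]
  then have len: "length (a @ i # b) = length w'"
    using Cons.prems by simp
  then obtain a' y b' where w': "w' = a' @ y # b'" "length a' = length a"
    by (metis append_eq_conv_conj id_take_nth_drop length_append length_take less_add_Suc1
        length_Cons min.absorb2 nat_le_linear not_less_eq_eq add_Suc_right length_append)
  have 1: "chg w w' = chg a a' + (if y = j then {#} else {#(y, j)#}) + chg b b'"
    and 2: "chg (a @ i # b) w' = chg a a' + (if y = i then {#} else {#(y, i)#}) + chg b b'"
    unfolding w w'(1) using w'(2) by (simp_all add: chg_append chg_Cons)
  show ?case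
  proof (cases "y = i")
    case True
    then show ?thesis
      using IH Cons.prems len 1 2 p w by auto
  next
    case False
    \<comment> \<open>The altered position still disagrees with \<open>w'\<close> after the step, so
      the count does not grow and the bound for \<open>p # ps\<close> is strict.\<close>
    then have "size (chg w w') \<le> size (chg (a @ i # b) w')"
      unfolding 1 2 by simp
    then show ?thesis
      using IH Cons.prems len w by auto
  qed
qed

text \<open>Letting each operator act on its own letter contributes 1, and nothing can cancel it;
  \<open>pre\<close> collects the letters already replaced.\<close>

lemma clw_positive: "clw ps (delta (pre @ map fst ps @ fil)) (pre @ map snd ps @ fil) > 0"
proof (induction ps arbitrary: pre)
  case (Cons p ps)
  have "0 < clw ps (delta ((pre @ [fst p]) @ map fst ps @ fil)) ((pre @ [fst p]) @ map snd ps @ fil)"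
    by (rule Cons)
  also have "\<dots> \<le> cl (fst p) (snd p) (clw ps (delta ((pre @ [fst p]) @ map fst ps @ fil)))
      (pre @ snd p # map snd ps @ fil)"
    using cl_ge[of _ pre "fst p" "map snd ps @ fil" "snd p"] by simp
  finally show ?case
    by simp
qed (simp add: delta_def)

lemma chg_pairs:
  assumes "\<forall>p\<in>set ps. fst p \<noteq> snd p"
  shows "chg (map snd ps @ fil) (map fst ps @ fil) = mset ps"
  using assms by (induction ps) (auto simp: chg_Cons chg_same)

text \<open>Isolates a leading term: the two words differ in exactly \<open>length ps\<close>
  positions, so fewer operators cannot link them, and equally many must be the same ones.\<close>

lemma clw_extremal:
  assumes "\<forall>p\<in>set ps. fst p \<noteq> snd p" "\<forall>p\<in>set qs. fst p \<noteq> snd p" "length qs \<le> length ps"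
    and "clw qs (delta (map fst ps @ fil)) (map snd ps @ fil) \<noteq> 0"
  shows "mset qs = mset ps"
proof -
  have "size (chg (map snd ps @ fil) (map fst ps @ fil)) = length ps"
    using chg_pairs[OF assms(1)] by simp
  then show ?thesis
    using clw_nonzero[OF assms(4,2)] chg_pairs[OF assms(1)] assms(3) by auto
qed

section \<open>Normal words are linearly independent\<close>

text \<open>A Vandermonde argument; as \<open>x a0\<close> is nonzero, equations for large exponents
  suffice.\<close>

lemma powers_independent:
  fixes x c :: "'a \<Rightarrow> 'b::field"
  assumes "finite A" "inj_on x A" "a0 \<in> A" "x a0 \<noteq> 0"
    and "\<And>L. L \<ge> L0 \<Longrightarrow> (\<Sum>a\<in>A. c a * x a ^ L) = 0"
  shows "c a0 = 0"
proof -
  \<comment> \<open>Up to a scalar this is the Lagrange polynomial that picks out the term of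
    \<open>a0\<close>.\<close>
  define p where "p = (\<Prod>b\<in>A - {a0}. [:- x b, 1:])"
  have "(\<Sum>a\<in>A. c a * x a ^ L0 * poly p (x a))
      = (\<Sum>a\<in>A. \<Sum>i\<le>degree p. coeff p i * (c a * x a ^ (L0 + i)))"
    by (simp add: poly_altdef sum_distrib_left power_add mult_ac)
  also have "\<dots> = (\<Sum>i\<le>degree p. coeff p i * (\<Sum>a\<in>A. c a * x a ^ (L0 + i)))"
    by (subst sum.swap) (simp add: sum_distrib_left)
  also have "\<dots> = 0"
    using assms(5) by simp
  finally have "(\<Sum>a\<in>A. c a * x a ^ L0 * poly p (x a)) = 0" .
  moreover have "poly p (x a) = 0" if "a \<in> A - {a0}" for a
    using assms(1) that unfolding p_def poly_prod by (intro prod_zero bexI[of _ a]) auto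
  then have "(\<Sum>a\<in>A. c a * x a ^ L0 * poly p (x a)) = c a0 * x a0 ^ L0 * poly p (x a0)"
    using assms(1,3) by (subst sum.remove[of _ a0]) auto
  moreover have "poly p (x a0) \<noteq> 0"
    using assms(1,2,3) unfolding p_def poly_prod by (auto dest: inj_onD)
  ultimately show ?thesis
    using assms(4) by simp
qed

text \<open>The differences are finitely many nonzero polynomials with finitely many roots;
  \<open>B\<close> avoids these and 0.\<close>

lemma poly_values_inj:
  fixes P :: "'a \<Rightarrow> int poly"
  assumes "finite A" "inj_on P A"
  obtains B :: nat where "B \<ge> 1" "inj_on (\<lambda>a. poly (P a) (int B)) A"
proof -
  define bad where "bad = (\<Union>(a, b)\<in>{(a, b). a \<in> A \<and> b \<in> A \<and> a \<noteq> b}. {z. poly (P a - P b) z = 0})"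
  have "finite {(a, b). a \<in> A \<and> b \<in> A \<and> a \<noteq> b}"
    by (rule finite_subset[of _ "A \<times> A"]) (use assms in auto)
  then have "finite bad"
    unfolding bad_def
  proof (rule finite_UN_I, clarify)
    fix a b assume "a \<in> A" "b \<in> A" "a \<noteq> b"
    then have "P a - P b \<noteq> 0"
      using assms(2) by (auto dest: inj_onD)
    then show "finite {z. poly (P a - P b) z = 0}"
      by (rule poly_roots_finite)
  qed
  then have "finite (insert 0 (int -` bad))"
    by (simp add: finite_vimageI)
  then obtain B :: nat where B: "B \<notin> insert 0 (int -` bad)"
    using ex_new_if_finite[OF infinite_UNIV_nat] by blast
  have "inj_on (\<lambda>a. poly (P a) (int B)) A"
  proof (rule inj_onI, rule ccontr)
    fix a b assume "a \<in> A" "b \<in> A" "poly (P a) (int B) = poly (P b) (int B)" "a \<noteq> b"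
    then have "int B \<in> bad"
      unfolding bad_def by auto
    with B show False
      by simp
  qed
  moreover have "B \<ge> 1"
    using B by (cases B) auto
  ultimately show ?thesis
    by (rule that[rotated])
qed

lemma vv_power: "vv ^ m = Fract ([:0, 1:] ^ m) 1"
  by (induction m) (simp_all add: One_fract_def, simp add: vv_def)

lemma vv_powi_inj: "inj (\<lambda>k. vv powi k)"
proof (rule linorder_injI)
  fix a b :: int assume "a < b"
  define m where "m = nat (b - a)"
  with \<open>a < b\<close> have m: "b = a + int m" "m > 0"
    by auto
  show "vv powi a \<noteq> vv powi b"
  proof
    assume "vv powi a = vv powi b"
    then have "vv ^ m = 1"
      unfolding m(1) by (simp add: power_int_add)
    then have "[:0, 1:] ^ m = (1 :: complex poly)"
      by (simp add: vv_power One_fract_def eq_fract)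
    then have "degree ([:0, 1:] ^ m :: complex poly) = 0"
      by simp
    with m(2) show False
      by (simp add: degree_power_eq)
  qed
qed

section \<open>Eigenvalues of words in the diagonal generators\<close>

fun sg :: "fgen \<Rightarrow> int" where
  "sg (TP i j) = 1"
| "sg (TM i j) = -1"

definition cartan :: "fgen \<Rightarrow> bool" where
  "cartan g \<longleftrightarrow> fst (pr g) = snd (pr g)"

text \<open>Encodes the net exponents of the diagonal generators as coefficients, so that weights
  \<open>B ^ i\<close> amount to evaluation at \<open>B\<close>.\<close>

definition cpoly :: "fgen list \<Rightarrow> int poly" where
  "cpoly cs = sum_list (map (\<lambda>g. monom (sg g) (fst (pr g))) cs)"

lemma actg_cartan:
  assumes "cartan g"
  shows "actg g G w = vv powi (sg g * int (count_list w (fst (pr g)))) * G w"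
  using assms by (cases g) (auto simp: cartan_def site_diag power_int_minus power_inverse)

text \<open>With weights \<open>L * B ^ i\<close> the eigenvalue is the power \<open>L\<close> of a
  number independent of \<open>L\<close>, which prepares the Vandermonde argument.\<close>

lemma actw_cartan:
  assumes "\<forall>g\<in>set cs. cartan g \<and> count_list w (fst (pr g)) = L * B ^ fst (pr g)"
  shows "actw cs G w = (vv powi poly (cpoly cs) (int B)) ^ L * G w"
  using assms
proof (induction cs)
  case (Cons g cs)
  have "actw (g # cs) G w = vv powi (sg g * int (L * B ^ fst (pr g)))
      * ((vv powi poly (cpoly cs) (int B)) ^ L * G w)"
    using Cons by (simp add: actg_cartan)
  also have "\<dots> = (vv powi poly (cpoly (g # cs)) (int B)) ^ L * G w"
    by (simp add: power_int_power' cpoly_def poly_monom power_int_add algebra_simps)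
  finally show ?case .
qed (simp add: cpoly_def)

lemma coeff_cpoly:
  assumes "\<forall>g\<in>set cs. cartan g"
  shows "coeff (cpoly cs) i = int (count (mset cs) (TP i i)) - int (count (mset cs) (TM i i))"
  using assms
proof (induction cs)
  case (Cons g cs)
  then show ?case
    by (cases g) (auto simp: cpoly_def cartan_def)
qed (simp add: cpoly_def)

lemma sorted_map_partition:
  assumes "sorted (map f xs)" "\<And>x. x \<in> set xs \<Longrightarrow> P x \<longleftrightarrow> f x < (c :: nat)"
  shows "xs = filter P xs @ filter (\<lambda>x. \<not> P x) xs"
  using assms
proof (induction xs)
  case (Cons x xs)
  show ?case
  proof (cases "P x")
    case True
    with Cons show ?thesis
      by simp
  next
    case False
    have "\<not> P y" if "y \<in> set xs" for y
    proof -
      have "f x \<le> f y"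
        using Cons.prems(1) that by simp
      then show ?thesis
        using Cons.prems(2)[of x] Cons.prems(2)[of y] False that by simp
    qed
    then have "filter P xs = []" "filter (\<lambda>x. \<not> P x) xs = xs"
      by (auto simp: filter_empty_conv intro: filter_True)
    with False show ?thesis
      by simp
  qed
qed simp

context
  fixes n :: nat
begin

lemma normal_fgens: "normal n xs \<Longrightarrow> set xs \<subseteq> fgens n"
  unfolding normal_def using lt_fgens by blast

lemma sorted_key_unique:
  assumes "mset xs = mset ys" "sorted (map (key n) xs)" "sorted (map (key n) ys)" "set xs \<subseteq> fgens n"
  shows "xs = ys"
proof -
  have "set ys = set xs"
    using assms(1) by (metis set_mset_mset)
  have "mset (map (key n) xs) = mset (map (key n) ys)"
    using assms(1) by simp
  then have "map (key n) xs = map (key n) ys"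
    using assms(2,3) by (metis properties_for_sort)
  moreover have "inj_on (key n) (set xs \<union> set ys)"
    using assms(4) \<open>set ys = set xs\<close> by (intro inj_on_subset[OF key_inj]) auto
  ultimately show ?thesis
    by (simp only: inj_on_map_eq_map)
qed

lemma normal_split:
  assumes "normal n xs"
  shows "xs = filter cartan xs @ filter (\<lambda>g. \<not> cartan g) xs"
proof (rule sorted_map_partition)
  show "sorted (map (key n) xs)"
    using assms by (simp add: normal_def)
next
  fix g assume "g \<in> set xs"
  then have "g \<in> fgens n"
    using normal_fgens[OF assms] by auto
  then show "cartan g \<longleftrightarrow> key n g < 2 * n + 2"
    by (auto simp: fgens_def cartan_def split: if_splits)
qed

lemma normal_off:
  assumes "normal n xs"
  shows "set (filter (\<lambda>g. \<not> cartan g) xs) \<subseteq> off n"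
proof
  fix g assume "g \<in> set (filter (\<lambda>g. \<not> cartan g) xs)"
  then have "g \<in> set xs" "\<not> cartan g"
    by auto
  then obtain e i j where g: "g = lt e i j" "valid e i j" "i \<in> {1..n}" "j \<in> {1..n}" "\<not> cartan g"
    using assms unfolding normal_def by blast
  then have "if e then i < j else j < i"
    by (auto simp: valid_def cartan_def split: if_splits)
  with g show "g \<in> off n"
    unfolding off_def by blast
qed

text \<open>The polynomial yields only differences of multiplicities, but in a normal word one of
  \<open>TP i i\<close>, \<open>TM i i\<close> is absent, so each difference determines
  both.\<close>

lemma normal_eqI:
  assumes "normal n xs" "normal n ys"
    and "filter (\<lambda>g. \<not> cartan g) xs = filter (\<lambda>g. \<not> cartan g) ys"
    and "cpoly (filter cartan xs) = cpoly (filter cartan ys)"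
  shows "xs = ys"
proof -
  have excl: "count (mset (filter cartan zs)) (TP i i) = 0 \<or> count (mset (filter cartan zs)) (TM i i) = 0"
    if "normal n zs" for zs i
    using that by (auto simp: normal_def count_eq_zero_iff)
  have *: "int a - int b = int c - int d \<Longrightarrow> a = 0 \<or> b = 0 \<Longrightarrow> c = 0 \<or> d = 0 \<Longrightarrow> a = c \<and> b = d"
    for a b c d
    by auto
  have "mset (filter cartan xs) = mset (filter cartan ys)"
  proof (rule multiset_eqI)
    fix g
    show "count (mset (filter cartan xs)) g = count (mset (filter cartan ys)) g"
    proof (cases "cartan g")
      case True
      then obtain i where g: "g = TP i i \<or> g = TM i i"
        by (cases g) (auto simp: cartan_def)
      have "coeff (cpoly (filter cartan xs)) i = coeff (cpoly (filter cartan ys)) i"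
        by (simp only: assms(4))
      then have "int (count (mset (filter cartan xs)) (TP i i)) - int (count (mset (filter cartan xs)) (TM i i))
          = int (count (mset (filter cartan ys)) (TP i i)) - int (count (mset (filter cartan ys)) (TM i i))"
        by (subst (asm) (1 2) coeff_cpoly) auto
      then have "count (mset (filter cartan xs)) (TP i i) = count (mset (filter cartan ys)) (TP i i)
          \<and> count (mset (filter cartan xs)) (TM i i) = count (mset (filter cartan ys)) (TM i i)"
        using excl[OF assms(1), of i] excl[OF assms(2), of i] by (rule *)
      with g show ?thesis
        by metis
    qed simp
  qed
  moreover have "mset xs = mset (filter cartan xs) + mset (filter (\<lambda>g. \<not> cartan g) xs)"
    "mset ys = mset (filter cartan ys) + mset (filter (\<lambda>g. \<not> cartan g) ys)"
    by simp_all
  ultimately have "mset xs = mset ys"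
    using assms(3) by (simp only:)
  then show ?thesis
    using assms(1,2) normal_fgens by (intro sorted_key_unique) (auto simp: normal_def)
qed

text \<open>For off-diagonal generators the order of the two indices tells \<open>TP\<close> from
  \<open>TM\<close>.\<close>

lemma pr_inj: "inj_on pr (off n)"
  by (rule inj_onI) (auto simp: off_def split: if_splits)

lemma off_pr: "g \<in> off n \<Longrightarrow> fst (pr g) \<noteq> snd (pr g) \<and> fst (pr g) \<in> {1..n} \<and> snd (pr g) \<in> {1..n}"
  by (auto simp: off_def split: if_splits)

lemma off_fgens: "off n \<subseteq> fgens n"
  by (auto simp: off_def fgens_def)

lemma off_words_eqI:
  assumes "mset (map pr xs) = mset (map pr ys)" "set xs \<subseteq> off n" "set ys \<subseteq> off n"
    and "sorted (map (key n) xs)" "sorted (map (key n) ys)"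
  shows "xs = ys"
proof (rule sorted_key_unique)
  have *: "image_mset (inv_into (off n) pr) (mset (map pr zs)) = mset zs" if "set zs \<subseteq> off n" for zs
  proof -
    have "map (inv_into (off n) pr \<circ> pr) zs = zs"
      using that by (intro map_idI) (auto simp: inv_into_f_f[OF pr_inj])
    then show ?thesis
      by (metis map_map mset_map)
  qed
  show "mset xs = mset ys"
    unfolding *[OF assms(2), symmetric] *[OF assms(3), symmetric] assms(1) ..
qed (use assms off_fgens in auto)

lemma word_with_counts: "\<exists>w. set w \<subseteq> {1..n} \<and> (\<forall>i\<in>{1..n}. count_list w i = g i)"
proof -
  have "\<exists>w. set w \<subseteq> {1..m} \<and> (\<forall>i\<in>{1..m}. count_list w i = g i)" for m :: nat
  proof (induction m)
    case (Suc m)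
    then obtain w where w: "set w \<subseteq> {1..m}" "\<forall>i\<in>{1..m}. count_list w i = g i"
      by auto
    have rep: "count_list (replicate k x) y = (if x = y then k else 0)" for k and x y :: nat
      by (induction k) auto
    from w(1) have "Suc m \<notin> set w"
      by auto
    with w show ?case
      by (intro exI[of _ "replicate (g (Suc m)) (Suc m) @ w"]) (auto simp: rep le_Suc_eq)
  qed (auto intro: exI[of _ "[]"])
  then show ?thesis .
qed

lemma normal_independent:
  assumes y: "\<And>w. w \<in> keys y \<Longrightarrow> normal n (letters w)" and act: "\<And>F w. act y F w = 0"
  shows "y = 0"
proof (rule ccontr)
  assume "y \<noteq> 0"
  then obtain u1 where u1: "u1 \<in> keys y"
    by (metis all_not_in_conv keys_eq_empty)
  define ct :: "fgen word \<Rightarrow> fgen list" where "ct u = filter cartan (letters u)" for u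
  define oo :: "fgen word \<Rightarrow> fgen list" where "oo u = filter (\<lambda>g. \<not> cartan g) (letters u)" for u
  \<comment> \<open>Bounds the length of every word; weights at least this large leave enough
    letters for all off-diagonal generators to act on separately.\<close>
  define L0 where "L0 = (\<Sum>u\<in>keys y. length (letters u))"
  have oo_length: "length (oo u) \<le> L0" if "u \<in> keys y" for u
  proof -
    have "length (letters u) \<le> L0"
      unfolding L0_def using that by (intro member_le_sum) auto
    then show ?thesis
      unfolding oo_def using length_filter_le[of _ "letters u"] by (metis order_trans)
  qed
  let ?A = "{u \<in> keys y. oo u = oo u1}"
  have "inj_on (\<lambda>u. cpoly (ct u)) ?A"
  proof (rule inj_onI)
    fix u u' assume u: "u \<in> ?A" "u' \<in> ?A" "cpoly (ct u) = cpoly (ct u')"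
    then have "oo u = oo u'" "normal n (letters u)" "normal n (letters u')"
      using y by simp_all
    then have "letters u = letters u'"
      using u(3) normal_eqI[of "letters u" "letters u'"] by (simp add: ct_def oo_def)
    then show "u = u'"
      by (metis Word_letters)
  qed
  moreover have "finite ?A"
    by simp
  ultimately obtain B :: nat where
    B: "B \<ge> 1" "inj_on (\<lambda>u. poly (cpoly (ct u)) (int B)) ?A"
    using poly_values_inj by blast
  define \<kappa> where "\<kappa> u = vv powi poly (cpoly (ct u)) (int B)" for u
  have "inj_on \<kappa> ?A"
    unfolding \<kappa>_def using comp_inj_on[OF B(2) inj_on_subset[OF vv_powi_inj]] by (simp add: o_def)
  define P where "P L o' = (\<Sum>u\<in>{u \<in> keys y. oo u = o'}. lookup y u * \<kappa> u ^ L)" for L o'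
  \<comment> \<open>On the words sharing the off-diagonal part of \<open>u1\<close> the bases
    \<open>\<kappa> u\<close> are distinct, so their weighted power sums cannot vanish for all large
    \<open>L\<close>.\<close>
  have "\<exists>L\<ge>L0. P L (oo u1) \<noteq> 0"
  proof (rule ccontr)
    assume "\<not> ?thesis"
    then have "lookup y u1 = 0"
      using powers_independent[of ?A \<kappa> u1 L0 "lookup y"] \<open>inj_on \<kappa> ?A\<close> u1
      unfolding P_def by (auto simp: \<kappa>_def)
    with u1 show False
      by (simp add: in_keys_iff)
  qed
  then obtain L where L: "L \<ge> L0" "P L (oo u1) \<noteq> 0"
    by auto
  \<comment> \<open>The factor \<open>whs o'\<close> compensates the division that makes
    off-diagonal operators regular at v = 1.\<close>
  define Q where "Q o' = P L o' * whs o'" for o'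
  let ?O = "oo ` keys y"
  have expand: "(\<Sum>o'\<in>?O. Q o' * (actw o' F w / whs o')) = 0"
    if w: "\<And>i. i \<in> {1..n} \<Longrightarrow> count_list w i = L * B ^ i" for F w
  proof -
    have "lookup y u * actw (letters u) F w = lookup y u * \<kappa> u ^ L * actw (oo u) F w"
      if u: "u \<in> keys y" for u
    proof -
      have "actw (letters u) F w = actw (ct u) (actw (oo u) F) w"
        unfolding ct_def oo_def actw_simps(3)[symmetric] using normal_split[OF y[OF u]] by simp
      also have "\<dots> = \<kappa> u ^ L * actw (oo u) F w"
        unfolding \<kappa>_def
      proof (rule actw_cartan, rule ballI)
        fix g assume "g \<in> set (ct u)"
        then have "g \<in> fgens n" "cartan g"
          using normal_fgens[OF y[OF u]] by (auto simp: ct_def)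
        then show "cartan g \<and> count_list w (fst (pr g)) = L * B ^ fst (pr g)"
          using w by (auto simp: fgens_def)
      qed
      finally show ?thesis
        by simp
    qed
    then have "0 = (\<Sum>u\<in>keys y. lookup y u * \<kappa> u ^ L * actw (oo u) F w)"
      unfolding act[of F w, symmetric] act_def by (rule sum.cong[OF refl])
    also have "\<dots> = (\<Sum>o'\<in>?O. \<Sum>u\<in>{u \<in> keys y. oo u = o'}. lookup y u * \<kappa> u ^ L * actw (oo u) F w)"
      by (rule sum.image_gen) simp
    also have "\<dots> = (\<Sum>o'\<in>?O. P L o' * actw o' F w)"
      unfolding P_def by (intro sum.cong refl) (simp add: sum_distrib_right)
    also have "\<dots> = (\<Sum>o'\<in>?O. Q o' * (actw o' F w / whs o'))"
      unfolding Q_def by (intro sum.cong refl) (simp add: whs_nonzero)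
    finally show ?thesis
      by simp
  qed
  have "Q (oo u1) \<noteq> 0"
    using L whs_nonzero by (simp add: Q_def)
  then obtain s q where q: "\<And>o'. o' \<in> ?O \<Longrightarrow> Reg (s * Q o') (q o')" "\<exists>o'\<in>?O. q o' \<noteq> 0"
    using normalise_at_1[of ?O "oo u1" Q] u1 by auto
  \<comment> \<open>Among the off-diagonal parts whose rescaled coefficient survives at v = 1, a
    longest one serves as leading term.\<close>
  let ?X = "{o' \<in> ?O. q o' \<noteq> 0}"
  have "finite (length ` ?X)" "length ` ?X \<noteq> {}"
    using q(2) by auto
  from Max_in[OF this] obtain o0 where X: "Max (length ` ?X) = length o0" "o0 \<in> ?X"
    by (rule imageE)
  then have o0: "o0 \<in> ?O" "q o0 \<noteq> 0" "length o0 = Max (length ` ?X)"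
    by simp_all
  have max: "length o' \<le> length o0" if "o' \<in> ?O" "q o' \<noteq> 0" for o'
    unfolding o0(3) using that by (intro Max_ge) auto
  have off: "set o' \<subseteq> off n" "sorted (map (key n) o')" if "o' \<in> ?O" for o'
    using that normal_off y unfolding oo_def by (force simp: normal_def intro: sorted_filter)+
  have pr: "\<forall>p\<in>set (map pr o'). fst p \<noteq> snd p" if "o' \<in> ?O" for o'
    using off(1)[OF that] off_pr by auto
  let ?ps = "map pr o0"
  \<comment> \<open>Filler letters, common to both words, bring all weights of \<open>w\<close> to
    the prescribed values.\<close>
  obtain fil where fil: "\<forall>i\<in>{1..n}. count_list fil i = L * B ^ i - count_list (map snd ?ps) i"
    using word_with_counts[of "\<lambda>i. L * B ^ i - count_list (map snd ?ps) i"] by auto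
  define w w' where "w = map snd ?ps @ fil" and "w' = map fst ?ps @ fil"
  have "count_list w i = L * B ^ i" if "i \<in> {1..n}" for i
  proof -
    \<comment> \<open>Rules out truncation in the subtraction that defines
      \<open>fil\<close>.\<close>
    have "count_list (map snd ?ps) i \<le> length o0"
      using count_le_length[of "map snd ?ps" i] by simp
    also have "\<dots> \<le> L * B ^ i"
      using o0(1) oo_length L(1) B(1)
      by (metis (no_types, lifting) imageE mult.right_neutral mult_le_mono order_trans one_le_power)
    finally show ?thesis
      using fil that by (simp add: w_def)
  qed
  note expand = expand[OF this, of "\<lambda>u. of_nat (delta w' u)"]
  have "Reg (\<Sum>o'\<in>?O. s * Q o' * (actw o' (\<lambda>u. of_nat (delta w' u)) w / whs o'))
      (\<Sum>o'\<in>?O. q o' * of_nat (clw (map pr o') (delta w') w))"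
  proof (intro Reg_sum Reg_mult q actw_off_Reg[where n = n] off)
    show "Reg (of_nat (delta w' u)) (of_nat (delta w' u))" for u
      by (simp add: delta_def Reg_0 Reg_1)
  qed
  moreover have "(\<Sum>o'\<in>?O. s * Q o' * (actw o' (\<lambda>u. of_nat (delta w' u)) w / whs o'))
      = s * (\<Sum>o'\<in>?O. Q o' * (actw o' (\<lambda>u. of_nat (delta w' u)) w / whs o'))"
    by (simp add: sum_distrib_left mult.assoc)
  ultimately have "Reg 0 (\<Sum>o'\<in>?O. q o' * of_nat (clw (map pr o') (delta w') w))"
    using expand by simp
  then have "(\<Sum>o'\<in>?O. q o' * of_nat (clw (map pr o') (delta w') w)) = 0"
    by (rule Reg_0_unique)
  \<comment> \<open>A part that survives at v = 1 is no longer than \<open>o0\<close>, so by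
    extremality a nonzero matrix coefficient would make it equal to \<open>o0\<close>.\<close>
  moreover have "q o' * of_nat (clw (map pr o') (delta w') w) = 0" if o': "o' \<in> ?O - {o0}" for o'
  proof (rule ccontr)
    assume "\<not> ?thesis"
    then have nz: "q o' \<noteq> 0" "clw (map pr o') (delta w') w \<noteq> 0"
      by auto
    have "mset (map pr o') = mset (map pr o0)"
      using o' nz max pr o0(1) unfolding w_def w'_def by (intro clw_extremal[of _ _ fil]) auto
    then have "o' = o0"
      using off o' o0(1) by (intro off_words_eqI) auto
    with o' show False
      by simp
  qed
  ultimately have "q o0 * of_nat (clw (map pr o0) (delta w') w) = 0"
    using o0(1) by (subst (asm) sum.remove[of _ o0]) auto
  moreover have "clw (map pr o0) (delta w') w > 0"
    using clw_positive[of ?ps "[]" fil] by (simp add: w_def w'_def)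
  ultimately show False
    using o0(2) by simp
qed

text \<open>The integral normal form \<open>y\<close> of \<open>x\<close> differs from it by an
  element of \<open>FL\<close>, which lies in \<open>FI\<close>; hence \<open>y\<close> acts by zero
  on tensor powers, and independence gives \<open>y = 0\<close>.\<close>

lemma torsion_free:
  assumes "x \<in> free_over Laur (fgens n)" "x \<in> FI n"
  shows "x \<in> FL n"
proof -
  from free_over_NS[OF assms(1)] obtain y where
    y: "\<forall>w\<in>keys y. normal n (letters w)" "x - y \<in> FL n"
    unfolding NS_def by auto
  have "x - y \<in> FI n"
    using y(2) ideal_mono unfolding FL_def FI_def by blast
  then have "act y F w = 0" for F w
    using act_ideal[of "x - y" n F w] act_ideal[of x n F w] assms(2)
    by (simp add: FI_def act_diff)
  then have "y = 0"
    using y(1) by (intro normal_independent) auto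
  with y(2) show ?thesis
    by simp
qed

end

theorem theorem3p7:
  fixes n :: nat and f :: "lgen free"
  assumes "n \<ge> 1"
  assumes "f \<in> free_over Laur (lgens n)"
  shows "subst evgen f \<in> ideal_gen Laur (fgens n) (frels n)
     \<longleftrightarrow> f \<in> ideal_gen UNIV (lgens n) (lrels n \<union> Igens)"
proof -
  have "subst evgen f \<in> free_over Laur (fgens n)"
    using assms(2) by (rule free_over_subst[OF scalar_ring_Laur]) (rule evgen_free[OF scalar_ring_Laur])
  then have "subst evgen f \<in> FL n \<longleftrightarrow> subst evgen f \<in> FI n"
    using torsion_free ideal_mono unfolding FL_def FI_def by blast
  also have "\<dots> \<longleftrightarrow> f \<in> LI n"
    using assms free_over_mono[OF assms(2), of UNIV] by (intro kernel_over_field) auto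
  finally show ?thesis
    by (simp add: FL_def LI_def)
qed

end
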